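(* Consider the selective routing game with one bufferless and one infinite-buffer server described in the context. Assume the service-time distribution $F$ is chosen such that (i) $\lambda<\mu$; (ii) $\mathrm{E}[Y^4]<\infty$; and (iii) $\mathbf{u}(\mathbf{p})$ is continuous in $\mathbf{p}\in\Delta$. Then for any initial strategy $\mathbf{p}^{(1)}\in\Delta$ and any positive step-size sequence $\{\gamma_n\}_{n\ge1}$ satisfying $\sum_{n=1}^\infty\gamma_n=\infty$ and $\sum_{n=1}^\infty\gamma_n^2<\infty$, the stochastic approximation algorithm $\mathbf{p}^{(n+1)}=\pi_\Delta\big(\mathbf{p}^{(n)}+\gamma_n\mathbf{G}^{(n)}\big)$, $n\ge1$, converges almost surely to a set of equilibrium strategies; that is, there is a set $\mathcal{S}^e\subseteq\Delta$ of equilibrium strategies such that $\inf_{\mathbf{x}\in\mathcal{S}^e}\Vert\mathbf{p}^{(n)}-\mathbf{x}\Vert\to0$ almost surely as $n\to\infty$.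
   Context: Notation: $\Delta=\{(p,1-p):p\in[0,1]\}\subset\mathbb{R}^2$; $\Vert\cdot\Vert$ is the Euclidean norm; $\pi_\Delta$ is the Euclidean projection onto $\Delta$; $'$ is transpose; $1(A)$ is the indicator of $A$. Model: there are two servers; Server 1 has no waiting room, Server 2 has an infinite-capacity queue. Customers arrive according to a Poisson process with rate $\lambda$, with i.i.d. service requirements distributed as $Y\sim F$, $\mathrm{E}[Y]=1/\mu$, independent of arrivals. Upon arrival, without observing the state, each customer chooses between action $a_1$ (sense) and action $a_2$ (not sense). A sensing customer pays a fixed cost $c_s$ (regardless of the outcome); if Server 1 is idle they start service there immediately, otherwise they are sent instantaneously to the end of Server 2's queue. A non-sensing customer pays no sensing cost and goes directly to the end of Server 2's queue. Customers queueing for Server 2 incur a waiting cost at rate $c_w$ per unit time. A strategy is $\mathbf{p}=(p,1-p)\in\Delta$ with $p$ the probability of sensing. The state is $x=(x^{[1]},x^{[2]})$, where $x^{[m]}$ is the workload at Server $m$ just before an arrival. The conditional expected value vector $\overline{\mathbf{v}}=(\overline{v}_1,\overline{v}_2)$ is $\overline{v}_1(x)=-c_s-c_w\cdot 1(x^{[1]}>0)\cdot x^{[2]}$ and $\overline{v}_2(x)=-c_w\cdot x^{[2]}$. Let $X(\mathbf{p})$ have the stationary distribution of the state at arrival epochs when all customers use $\mathbf{p}$, and $\mathbf{u}(\mathbf{p})=\mathrm{E}_{\mathbf{p}}[\overline{\mathbf{v}}(X(\mathbf{p}))]$. A strategy $\mathbf{p}$ is a (symmetric Nash) equilibrium if $\mathbf{p}\in\arg\max_{\mathbf{q}\in\Delta}\mathbf{u}(\mathbf{p})'\mathbf{q}$.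 Algorithm: a regeneration cycle under $\mathbf{p}$ starts with an arrival to an empty system, $X_1=(0,0)$; $X_j$ is the state seen by the $j$-th arrival, and $L=\inf\{n\ge1:X_{n+1}=(0,0)\}$. The cycle estimator is $\mathbf{G}=\sum_{j=1}^L\overline{\mathbf{v}}(X_j)$. At iteration $n$, conditionally on the past of the algorithm up to and including $\mathbf{p}^{(n)}$, $\mathbf{G}^{(n)}$ is distributed as $\mathbf{G}$ under strategy $\mathbf{p}^{(n)}$ (a freshly simulated cycle). *)

theory Defs
  imports "HOL-Probability.Probability"
begin

text \<open>
  Strategies and states are pairs of reals; the norm and the inner product of the product type
  \<^typ>\<open>real \<times> real\<close> are the Euclidean ones. A state holds the two workloads seen by an arriving
  customer. The parameters \<open>lam\<close>, \<open>F\<close>, \<open>cs\<close>, \<open>cw\<close> are the arrival rate, the service-time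
  distribution, the sensing cost and the waiting-cost rate.
\<close>

definition strategies :: "(real \<times> real) set" where
  "strategies = {(p, 1 - p) | p. p \<in> {0..1}}"

definition vbar :: "real \<Rightarrow> real \<Rightarrow> real \<times> real \<Rightarrow> real \<times> real" where
  "vbar cs cw x = (- cs - cw * of_bool (fst x > 0) * snd x, - cw * snd x)"

text \<open>
  Law of the triple (does the customer sense, service requirement, time until the next arrival).
  The components are independent, and the interarrival times of the Poisson process are exponential.
\<close>

definition input_law ::
    "real \<Rightarrow> real measure \<Rightarrow> real \<times> real \<Rightarrow> (bool \<times> real \<times> real) measure" where
  "input_law lam F p =
     measure_pmf (bernoulli_pmf (fst p)) \<Otimes>\<^sub>M (F \<Otimes>\<^sub>M density lborel (exponential_density lam))"

text \<open>
  The workload vector seen by the next arrival: the requirement is added to the workload of the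
  server the customer is routed to, then each server works off its workload at unit rate.
\<close>

definition next_state :: "real \<times> real \<Rightarrow> bool \<times> real \<times> real \<Rightarrow> real \<times> real" where
  "next_state x = (\<lambda>(sense, y, t).
     if sense \<and> fst x = 0 then (max 0 (y - t), max 0 (snd x - t))
     else (max 0 (fst x - t), max 0 (snd x + y - t)))"

definition stationary ::
    "real \<Rightarrow> real measure \<Rightarrow> real \<times> real \<Rightarrow> (real \<times> real) measure \<Rightarrow> bool" where
  "stationary lam F p \<nu> \<longleftrightarrow>
     prob_space \<nu> \<and> sets \<nu> = sets borel \<and>
     distr (\<nu> \<Otimes>\<^sub>M input_law lam F p) borel (\<lambda>(x, z). next_state x z) = \<nu>"

definition stationary_law ::
    "real \<Rightarrow> real measure \<Rightarrow> real \<times> real \<Rightarrow> (real \<times> real) measure" where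
  "stationary_law lam F p = (THE \<nu>. stationary lam F p \<nu>)"

definition utility ::
    "real \<Rightarrow> real measure \<Rightarrow> real \<Rightarrow> real \<Rightarrow> real \<times> real \<Rightarrow> real \<times> real" where
  "utility lam F cs cw p = (\<integral>x. vbar cs cw x \<partial>stationary_law lam F p)"

definition equilibrium ::
    "real \<Rightarrow> real measure \<Rightarrow> real \<Rightarrow> real \<Rightarrow> real \<times> real \<Rightarrow> bool" where
  "equilibrium lam F cs cw p \<longleftrightarrow>
     is_arg_max (\<lambda>q. utility lam F cs cw p \<bullet> q) (\<lambda>q. q \<in> strategies) p"

text \<open>
  The states seen by successive arrivals when the first one finds an empty system, driven by a
  sequence of inputs. Indices are shifted: \<open>seen z j\<close> is the state $X_{j+1}$.
\<close>

primrec seen :: "(nat \<Rightarrow> bool \<times> real \<times> real) \<Rightarrow> nat \<Rightarrow> real \<times> real" where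
  "seen z 0 = (0, 0)"
| "seen z (Suc j) = next_state (seen z j) (z j)"

text \<open>
  If the system never empties again, the infimum in \<^typ>\<open>nat\<close> is 0 instead of infinity; for a
  stable system this event has probability 0.
\<close>

definition cycle_length :: "(nat \<Rightarrow> bool \<times> real \<times> real) \<Rightarrow> nat" where
  "cycle_length z = Inf {n. n \<ge> 1 \<and> seen z n = (0, 0)}"

definition cycle_sum ::
    "real \<Rightarrow> real \<Rightarrow> (nat \<Rightarrow> bool \<times> real \<times> real) \<Rightarrow> real \<times> real" where
  "cycle_sum cs cw z = (\<Sum>j<cycle_length z. vbar cs cw (seen z j))"

definition cycle_law ::
    "real \<Rightarrow> real measure \<Rightarrow> real \<Rightarrow> real \<Rightarrow> real \<times> real \<Rightarrow> (real \<times> real) measure" where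
  "cycle_law lam F cs cw p =
     distr (\<Pi>\<^sub>M (_::nat)\<in>UNIV. input_law lam F p) borel (cycle_sum cs cw)"

text \<open>
  The past at iteration \<open>n\<close>: the sigma-algebra generated by $P_1, \dots, P_n$ and
  $G_1, \dots, G_{n-1}$.
\<close>

definition past ::
    "'w measure \<Rightarrow> (nat \<Rightarrow> 'w \<Rightarrow> real \<times> real) \<Rightarrow> (nat \<Rightarrow> 'w \<Rightarrow> real \<times> real) \<Rightarrow> nat \<Rightarrow> 'w measure"
where
  "past M P G n = sigma (space M)
     ({P k -` B \<inter> space M | k B. k \<in> {1..n} \<and> B \<in> sets borel} \<union>
      {G k -` B \<inter> space M | k B. k \<in> {1..<n} \<and> B \<in> sets borel})"

end

theory Submission
  imports Defs
begin

text \<open>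
  A strategy \<open>(x, 1 - x)\<close> is determined by \<open>x \<in> [0, 1]\<close>, and in this coordinate the projected
  algorithm is the recursion \<open>x \<leftarrow> clip (x + \<gamma> \<Delta> / 2)\<close>, where \<open>\<Delta>\<close> is the difference of the two
  components of the cycle sum and \<open>clip\<close> truncates to \<open>[0, 1]\<close>. Write \<open>\<delta> x\<close> for the difference
  of the two components of the utility. The point \<open>x\<close> is an equilibrium iff \<open>\<delta> x\<close> does not
  point from \<open>x\<close> into the rest of the interval. The proof compares the recursion with an ascent
  along \<open>\<delta>\<close>.

  \<^bold>\<open>Mean of a step.\<close> A cycle starts and ends with an empty system, so the states seen during a cycle
  describe the stationary law: the expectation of \<open>\<Delta>\<close> is the mean cycle length times \<open>\<delta> x\<close>
  (\<open>renewal_reward\<close>). The mean cycle length lies between 1 and a constant that does not depend on the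
  strategy, so it rescales the drift without changing its sign. That the stationary law exists and is
  unique comes from the same cycle formula (\<open>stationary_law_eq\<close>).

  \<^bold>\<open>Variance of a step.\<close> Whatever the routing, the larger of the two workloads is dominated by the
  workload of a single server that receives all customers. Since \<open>lam < mu\<close>, quadratic and quartic
  functions of this load have negative drift. The quadratic one bounds the total load seen in
  a cycle, the quartic one its second moment (\<open>reward_second_moment\<close>). The quartic function is where
  four moments of the service time enter, and the bounds hold for all strategies at once
  (\<open>uniform_cycle_moments\<close>).

  \<^bold>\<open>Noise.\<close> Given the past, the deviations of the steps from their means are therefore centred with
  uniformly bounded variance, and as the squares of the step sizes are summable, the weighted
  deviations form an almost surely convergent series (\<open>AE_convergent\<close>).

  \<^bold>\<open>Limit.\<close> The rest is deterministic. Near a point that is not an equilibrium the drift has a constant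
  sign and is bounded away from 0. The steps sum to infinity while the remaining noise is
  small, so the iterates cross the neighbourhood in the direction of the drift and cannot
  come back (\<open>eventually_leaves_by_drift\<close>). By compactness finitely many such neighbourhoods cover
  all points at a given distance from the equilibria.
\<close>

section \<open>Projected ascent on the unit interval\<close>

text \<open>
  Around \<open>c\<close> the drift pushes to the right and the upper end 1 is too far away to interfere. Once the
  remaining noise is smaller than a fraction of \<open>\<delta>\<close>, an iterate near \<open>c\<close> is carried past
  \<open>c + \<delta>\<close>, because the step sizes sum to infinity. From there it could return only against the drift.
  Truncation at 0 can only help, as it moves the iterate to the right.
\<close>

lemma eventually_leaves_by_drift:
  fixes q h e g :: "nat \<Rightarrow> real"
  assumes rec: "\<And>n. q (Suc n) = max 0 (min 1 (q n + g n * h n + g n * e n))"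
    and g: "\<And>n. 0 < g n" "g \<longlonglongrightarrow> 0" "filterlim (\<lambda>N. \<Sum>n<N. g n) at_top at_top"
    and h: "\<And>n. \<bar>h n\<bar> \<le> C"
    and noise: "convergent (\<lambda>N. \<Sum>n<N. g n * e n)"
    and c: "0 < \<delta>" "0 < \<eta>" "c + 3 * \<delta> \<le> 1"
    and drift: "\<And>n. \<bar>q n - c\<bar> \<le> 2 * \<delta> \<Longrightarrow> \<eta> \<le> h n"
  shows "eventually (\<lambda>n. \<delta> \<le> \<bar>q n - c\<bar>) sequentially"
proof -
  define s where "s N = (\<Sum>n<N. g n * e n)" for N
  obtain L where L: "s \<longlonglongrightarrow> L"
    using noise unfolding s_def convergent_def by blast
  \<comment> \<open>Adding the future noise turns \<open>q\<close> into a process that moves by the drift alone.\<close>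
  define r where "r n = q n + (L - s n)" for n
  have "(\<lambda>n. L - s n) \<longlonglongrightarrow> 0"
    using tendsto_diff[OF tendsto_const[of L] L] by simp
  from tendstoD[OF this, of "\<delta> / 4"] c have e1: "eventually (\<lambda>n. \<bar>L - s n\<bar> < \<delta> / 4) sequentially"
    by (simp add: dist_real_def)
  have "(\<lambda>n. s (Suc n) - s n) \<longlonglongrightarrow> 0"
    using tendsto_diff[OF LIMSEQ_Suc[OF L] L] by simp
  from tendstoD[OF this, of "\<delta> / 4"] c have e2: "eventually (\<lambda>n. \<bar>g n * e n\<bar> < \<delta> / 4) sequentially"
    by (simp add: dist_real_def s_def)
  have "(\<lambda>n. g n * C) \<longlonglongrightarrow> 0"
    using tendsto_mult_right[OF g(2), of C] by simp
  from tendstoD[OF this, of "\<delta> / 4"] c have e3: "eventually (\<lambda>n. \<bar>g n * C\<bar> < \<delta> / 4) sequentially"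
    by (simp add: dist_real_def)
  from eventually_conj[OF e1 eventually_conj[OF e2 e3]]
  obtain N where N: "\<And>n. N \<le> n \<Longrightarrow> \<bar>L - s n\<bar> < \<delta> / 4"
      "\<And>n. N \<le> n \<Longrightarrow> \<bar>g n * e n\<bar> < \<delta> / 4" "\<And>n. N \<le> n \<Longrightarrow> \<bar>g n * C\<bar> < \<delta> / 4"
    unfolding eventually_sequentially by blast
  have gh: "\<bar>g n * h n\<bar> < \<delta> / 4" if "N \<le> n" for n
  proof -
    have "\<bar>g n * h n\<bar> = g n * \<bar>h n\<bar>"
      using g(1)[of n] by (simp add: abs_mult)
    also have "\<dots> \<le> g n * C"
      using h[of n] g(1)[of n] by (intro mult_left_mono) auto
    finally show ?thesis
      using N(3)[OF that] by linarith
  qed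
  have rq: "\<bar>r n - q n\<bar> < \<delta> / 4" if "N \<le> n" for n
    using N(1)[OF that] by (simp add: r_def)
  have near: "r n + g n * \<eta> \<le> r (Suc n)" if n: "N \<le> n" "\<bar>q n - c\<bar> \<le> 2 * \<delta>" for n
  proof -
    have "q n + g n * h n + g n * e n \<le> 1"
      using n(2) gh[OF n(1)] N(2)[OF n(1)] c by linarith
    then have "q n + g n * h n + g n * e n \<le> q (Suc n)"
      unfolding rec[of n] by simp
    moreover have "g n * \<eta> \<le> g n * h n"
      using drift[OF n(2)] g(1)[of n] by simp
    ultimately show ?thesis
      by (simp add: r_def s_def)
  qed
  have above: "c + 5 / 4 * \<delta> \<le> r (Suc n)" if n: "N \<le> n" "c + 2 * \<delta> \<le> q n" for n
  proof -
    have "c + 3 / 2 * \<delta> \<le> q n + g n * h n + g n * e n"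
      using n(2) gh[OF n(1)] N(2)[OF n(1)] c by linarith
    moreover have "c + 3 / 2 * \<delta> \<le> 1"
      using c by linarith
    ultimately have "c + 3 / 2 * \<delta> \<le> q (Suc n)"
      unfolding rec[of n] by (simp add: max_def min_def)
    with rq[of "Suc n"] n(1) show ?thesis by linarith
  qed
\<comment> \<open>Every level in this range is a barrier that \<open>r\<close> does not cross downwards.\<close>
  have absorb: "b \<le> r n" if b: "c - 5 / 4 * \<delta> \<le> b" "b \<le> c + 5 / 4 * \<delta>"
      and "N \<le> m" "b \<le> r m" "m \<le> n" for b m n
    using that(5)
  proof (induction n rule: dec_induct)
    case base
    show ?case by fact
  next
    case (step n)
    have n: "N \<le> n" using step \<open>N \<le> m\<close> by simp
    show ?case
    proof (cases "c + 2 * \<delta> \<le> q n")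
      case True
      from above[OF n this] b show ?thesis by linarith
    next
      case False
      then have "\<bar>q n - c\<bar> \<le> 2 * \<delta>"
        using rq[OF n] step(3) b c by linarith
      moreover have "0 < g n * \<eta>"
        using g(1)[of n] c by simp
      ultimately show ?thesis
        using near[OF n] step(3) by linarith
    qed
  qed
  show ?thesis
  proof (cases "\<exists>m\<ge>N. \<bar>q m - c\<bar> < \<delta>")
    case False
    then show ?thesis
      unfolding eventually_sequentially by (metis not_less)
  next
    case True
    then obtain m where m: "N \<le> m" "\<bar>q m - c\<bar> < \<delta>" by blast
    have low: "c - 5 / 4 * \<delta> \<le> r n" if "m \<le> n" for n
      using rq[OF m(1)] m c that by (intro absorb[OF _ _ m(1) _ that]) linarith+
    have "\<exists>n\<ge>m. c + 5 / 4 * \<delta> \<le> r n"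
    proof (rule ccontr)
      assume "\<not> ?thesis"
      then have up: "r n < c + 5 / 4 * \<delta>" if "m \<le> n" for n
        using that by (meson not_less)
      have grow: "r m + \<eta> * ((\<Sum>k<n. g k) - (\<Sum>k<m. g k)) \<le> r n" if "m \<le> n" for n
        using that
      proof (induction n rule: dec_induct)
        case base
        show ?case by simp
      next
        case (step n)
        have "\<bar>q n - c\<bar> \<le> 2 * \<delta>"
          using rq[of n] low[of n] up[of n] step m(1) by linarith
        from near[OF _ this] step m(1) show ?case
          by (simp add: algebra_simps)
      qed
      obtain n where n: "m \<le> n" "(\<Sum>k<m. g k) + (3 * \<delta>) / \<eta> \<le> (\<Sum>k<n. g k)"
        using g(3)[unfolded filterlim_at_top, rule_format, of "(\<Sum>k<m. g k) + (3 * \<delta>) / \<eta>"]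
        by (metis (mono_tags, lifting) eventually_sequentially linear order_trans)
      have "3 * \<delta> = \<eta> * ((3 * \<delta>) / \<eta>)"
        using c by simp
      also have "\<dots> \<le> \<eta> * ((\<Sum>k<n. g k) - (\<Sum>k<m. g k))"
        using n(2) c by (intro mult_left_mono) linarith+
      finally show False
        using grow[OF n(1)] low[of m] up[OF n(1)] c by linarith
    qed
    then obtain n where n: "m \<le> n" "c + 5 / 4 * \<delta> \<le> r n" by blast
    have "\<delta> \<le> \<bar>q k - c\<bar>" if "n \<le> k" for k
    proof -
      have "c + 5 / 4 * \<delta> \<le> r k"
        using n m(1) c(1) that by (intro absorb[of _ n k]) linarith+
      then show ?thesis
        using rq[of k] that n m by linarith
    qed
    then show ?thesis
      unfolding eventually_sequentially by blast
  qed
qed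

lemma drift_interval:
  fixes d :: "real \<Rightarrow> real"
  assumes d: "continuous_on {0..1} d" and c: "c \<in> {0..1}" "0 < d c" "c < 1"
  obtains \<delta> \<eta> where "0 < \<delta>" "0 < \<eta>" "c + 3 * \<delta> \<le> 1"
    "\<And>x. x \<in> {0..1} \<Longrightarrow> \<bar>x - c\<bar> \<le> 2 * \<delta> \<Longrightarrow> \<eta> \<le> d x"
proof -
  obtain \<rho> where \<rho>: "0 < \<rho>" "\<And>x. x \<in> {0..1} \<Longrightarrow> dist x c < \<rho> \<Longrightarrow> dist (d x) (d c) < d c / 2"
    using d c unfolding continuous_on_iff by (metis half_gt_zero)
  define \<delta> where "\<delta> = min (\<rho> / 3) ((1 - c) / 3)"
  have \<delta>: "0 < \<delta>" "\<delta> \<le> \<rho> / 3" "\<delta> \<le> (1 - c) / 3"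
    unfolding \<delta>_def by (use \<rho>(1) c in simp, rule min.cobounded1, rule min.cobounded2)
  show thesis
  proof (rule that[of \<delta> "d c / 2"])
    fix x :: real
    assume x: "x \<in> {0..1}" "\<bar>x - c\<bar> \<le> 2 * \<delta>"
    then have "dist x c < \<rho>"
      using \<rho>(1) \<delta>(2) unfolding dist_real_def by linarith
    from \<rho>(2)[OF x(1) this] show "d c / 2 \<le> d x"
      unfolding dist_real_def by linarith
  next
    show "c + 3 * \<delta> \<le> 1"
      using \<delta>(3) by simp
  qed (use \<delta> c in auto)
qed

text \<open>
  The factors \<open>l n\<close> vary between 1 and \<open>C\<close>: they keep the sign of the drift and a lower bound
  on its size, which is what \<open>eventually_leaves_by_drift\<close> requires. Points with negative drift
  are treated by the reflection \<open>x \<mapsto> 1 - x\<close>.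
\<close>

lemma projected_ascent_converges:
  fixes d :: "real \<Rightarrow> real"
  fixes q l e g :: "nat \<Rightarrow> real"
  assumes rec: "\<And>n. q (Suc n) = max 0 (min 1 (q n + g n * (l n * d (q n)) + g n * e n))"
    and q0: "q 0 \<in> {0..1}"
    and g: "\<And>n. 0 < g n" "g \<longlonglongrightarrow> 0" "filterlim (\<lambda>N. \<Sum>n<N. g n) at_top at_top"
    and l: "\<And>n. 1 \<le> l n" "\<And>n. l n \<le> C"
    and d: "continuous_on {0..1} d"
    and noise: "convergent (\<lambda>N. \<Sum>n<N. g n * e n)"
  shows "(\<lambda>n. infdist (q n) {x \<in> {0..1}. (x < 1 \<longrightarrow> d x \<le> 0) \<and> (0 < x \<longrightarrow> 0 \<le> d x)}) \<longlonglongrightarrow> 0"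
    (is "(\<lambda>n. infdist (q n) ?E) \<longlonglongrightarrow> 0")
proof -
  have q: "q n \<in> {0..1}" for n
    by (cases n) (use q0 rec in auto)
  obtain B where B: "\<And>x. x \<in> {0..1} \<Longrightarrow> \<bar>d x\<bar> \<le> B"
    using compact_continuous_image[OF d compact_Icc, THEN compact_imp_bounded]
    unfolding bounded_iff ball_simps real_norm_def by blast
  have C0: "0 \<le> C" using l[of 0] by linarith
  have h: "\<bar>l n * d (q n)\<bar> \<le> C * B" for n
    unfolding abs_mult using l[of n] B[OF q[of n]] C0 by (intro mult_mono) auto
  have avoid: "\<exists>\<delta>>0. eventually (\<lambda>n. \<delta> \<le> \<bar>q n - c\<bar>) sequentially"
    if c: "c \<in> {0..1}" "c \<notin> ?E" for c
  proof (cases "c < 1 \<and> 0 < d c")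
    case True
    with c(1) obtain \<delta> \<eta> where \<delta>: "0 < \<delta>" "0 < \<eta>" "c + 3 * \<delta> \<le> 1"
        "\<And>x. x \<in> {0..1} \<Longrightarrow> \<bar>x - c\<bar> \<le> 2 * \<delta> \<Longrightarrow> \<eta> \<le> d x"
      using drift_interval[OF d] by metis
    have "\<eta> \<le> l n * d (q n)" if "\<bar>q n - c\<bar> \<le> 2 * \<delta>" for n
    proof -
      have "1 * \<eta> \<le> l n * d (q n)"
        using \<delta>(2) \<delta>(4)[OF q that] l(1)[of n] by (intro mult_mono) auto
      then show ?thesis by simp
    qed
    with eventually_leaves_by_drift[OF rec g h noise \<delta>(1-3)] \<delta>(1) show ?thesis by blast
  next
    case False
    with c have c': "0 < c" "d c < 0" by auto
    have "continuous_on {0..1} (\<lambda>x. - d (1 - x))"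
      by (intro continuous_intros continuous_on_compose2[OF d]) auto
    then obtain \<delta> \<eta> where \<delta>: "0 < \<delta>" "0 < \<eta>" "(1 - c) + 3 * \<delta> \<le> 1"
        "\<And>x. x \<in> {0..1} \<Longrightarrow> \<bar>x - (1 - c)\<bar> \<le> 2 * \<delta> \<Longrightarrow> \<eta> \<le> - d (1 - x)"
      using drift_interval[of "\<lambda>x. - d (1 - x)" "1 - c"] c c' by (auto simp del: max_less_iff_conj)
    have rec': "1 - q (Suc n) = max 0 (min 1 ((1 - q n) + g n * (- (l n * d (q n))) + g n * (- e n)))" for n
      unfolding rec[of n] by (auto simp: max_def min_def)
    have h': "\<bar>- (l n * d (q n))\<bar> \<le> C * B" for n
      using h[of n] by simp
    have noise': "convergent (\<lambda>N. \<Sum>n<N. g n * (- e n))"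
      using convergent_minus_iff[THEN iffD1, OF noise] by (simp add: sum_negf)
    have "\<eta> \<le> - (l n * d (q n))" if "\<bar>(1 - q n) - (1 - c)\<bar> \<le> 2 * \<delta>" for n
    proof -
      have "1 * \<eta> \<le> l n * (- d (q n))"
        using \<delta>(2) \<delta>(4)[of "1 - q n"] that q[of n] l(1)[of n] by (intro mult_mono) auto
      then show ?thesis by simp
    qed
    from eventually_leaves_by_drift[of "\<lambda>n. 1 - q n", OF rec' g h' noise' \<delta>(1-3) this]
    have "eventually (\<lambda>n. \<delta> \<le> \<bar>(1 - q n) - (1 - c)\<bar>) sequentially" by simp
    then show ?thesis
      using \<delta>(1) by (intro exI[of _ \<delta>]) (simp add: abs_minus_commute)
  qed
  define E where "E = ?E"
  have "(\<lambda>n. infdist (q n) E) \<longlonglongrightarrow> 0"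
  proof (rule tendstoI)
    fix \<epsilon> :: real
    assume \<epsilon>: "0 < \<epsilon>"
    define K where "K = {0..1} \<inter> {x. \<epsilon> \<le> infdist x E}"
    have "closed {x. \<epsilon> \<le> infdist x E}"
      by (intro closed_Collect_le continuous_intros)
    then have "compact K"
      unfolding K_def by (intro compact_Int_closed) auto
    have "c \<in> {0..1} \<and> c \<notin> E" if "c \<in> K" for c
      using that \<epsilon> infdist_zero[of c E] unfolding K_def by (metis IntE mem_Collect_eq not_less)
    then obtain \<delta> where \<delta>: "\<And>c. c \<in> K \<Longrightarrow> 0 < \<delta> c"
        "\<And>c. c \<in> K \<Longrightarrow> eventually (\<lambda>n. \<delta> c \<le> \<bar>q n - c\<bar>) sequentially"
      using avoid unfolding E_def[symmetric] by metis
    obtain T where T: "T \<subseteq> K" "finite T" "K \<subseteq> (\<Union>c\<in>T. ball c (\<delta> c))"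
    proof (rule compactE_image[OF \<open>compact K\<close>, of K "\<lambda>c. ball c (\<delta> c)"])
      show "K \<subseteq> (\<Union>c\<in>K. ball c (\<delta> c))"
        using \<delta>(1) by (meson UN_I centre_in_ball subsetI)
    qed simp_all
    have "eventually (\<lambda>n. \<forall>c\<in>T. \<delta> c \<le> \<bar>q n - c\<bar>) sequentially"
      using T \<delta>(2) by (intro eventually_ball_finite) auto
    then show "eventually (\<lambda>n. dist (infdist (q n) E) 0 < \<epsilon>) sequentially"
    proof (rule eventually_mono)
      fix n
      assume "\<forall>c\<in>T. \<delta> c \<le> \<bar>q n - c\<bar>"
      then have "q n \<notin> K"
        using T(3) unfolding dist_real_def subset_iff UN_iff mem_ball
        by (metis abs_minus_commute not_less)
      then show "dist (infdist (q n) E) 0 < \<epsilon>"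
        using q[of n] by (auto simp: K_def dist_real_def infdist_nonneg)
    qed
  qed
  then show ?thesis unfolding E_def .
qed

text \<open>
  If neither end of the interval is such a point, then \<open>d\<close> changes sign in between.
\<close>

lemma equilibrium_coordinate_exists:
  fixes d :: "real \<Rightarrow> real"
  assumes "continuous_on {0..1} d"
  shows "\<exists>x\<in>{0..1}. (x < 1 \<longrightarrow> d x \<le> 0) \<and> (0 < x \<longrightarrow> 0 \<le> d x)"
proof (cases "0 < d 0 \<and> d 1 < 0")
  case True
  then obtain x where "0 \<le> x" "x \<le> 1" "d x = 0"
    using IVT2'[of d 1 0 0] assms by auto
  then show ?thesis by (intro bexI[of _ x]) auto
next
  case False
  then show ?thesis
    by (metis atLeastAtMost_iff less_irrefl not_less order_refl zero_le_one)
qed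

section \<open>Conditional expectations given by a kernel\<close>

text \<open>
  The conditional law of \<open>X\<close> is known one event at a time, with an exceptional null set for each event.
  Measure-theoretic induction over \<open>\<phi>\<close> needs only countably many of these null sets. The integrals
  over \<open>\<kappa> \<omega>\<close> are handled through the conditional expectations with which they agree almost
  everywhere, since those are measurable in \<open>\<omega>\<close> by construction.
\<close>

lemma nn_cond_exp_kernel:
  fixes X :: "'w \<Rightarrow> 'b::topological_space"
  assumes "prob_space M" "subalgebra M H"
    and X [measurable]: "X \<in> borel_measurable M"
    and \<kappa>: "\<And>\<omega>. prob_space (\<kappa> \<omega>)" "\<And>\<omega>. sets (\<kappa> \<omega>) = sets borel"
    and law: "\<And>B. B \<in> sets borel \<Longrightarrow>
      AE \<omega> in M. real_cond_exp M H (\<lambda>\<omega>. indicator B (X \<omega>)) \<omega> = measure (\<kappa> \<omega>) B"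
    and \<phi>: "\<phi> \<in> borel_measurable borel"
  shows "AE \<omega> in M. nn_cond_exp M H (\<lambda>\<omega>. \<phi> (X \<omega>)) \<omega> = (\<integral>\<^sup>+ v. \<phi> v \<partial>\<kappa> \<omega>)"
  using \<phi>
proof (induction rule: borel_measurable_induct)
  interpret prob_space M by fact
  interpret finite_measure_subalgebra M H
    by unfold_locales fact
  have [measurable_cong]: "sets (\<kappa> \<omega>) = sets borel" for \<omega> by (rule \<kappa>(2))
  {
    case (cong f g)
    then have "f = g" by auto
    with cong show ?case by simp
  next
    case (set B)
    note [measurable] = set
    have "AE \<omega> in M. nn_cond_exp M H (\<lambda>\<omega>. indicator B (X \<omega>)) \<omega> \<le> nn_cond_exp M H (\<lambda>\<omega>. 1) \<omega>"
      by (rule nn_cond_exp_mono) (auto split: split_indicator)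
    moreover have "AE \<omega> in M. (1 :: ennreal) = nn_cond_exp M H (\<lambda>\<omega>. 1) \<omega>"
      by (rule nn_cond_exp_F_meas) simp
    moreover have "AE \<omega> in M. (0 :: ennreal) = nn_cond_exp M H (\<lambda>\<omega>. 0) \<omega>"
      by (rule nn_cond_exp_F_meas) simp
    ultimately show ?case
      using law[OF set]
    proof eventually_elim
      case (elim \<omega>)
      interpret \<kappa>: prob_space "\<kappa> \<omega>" by (rule \<kappa>(1))
      have fin: "nn_cond_exp M H (\<lambda>\<omega>. indicator B (X \<omega>)) \<omega> < top"
        using elim(1,2) by (metis ennreal_one_less_top le_less_trans)
      have "(\<lambda>\<omega>. ennreal (- indicator B (X \<omega>))) = (\<lambda>_. 0)"
        by (auto simp: fun_eq_iff ennreal_neg)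
      then have "enn2real (nn_cond_exp M H (\<lambda>\<omega>. indicator B (X \<omega>)) \<omega>) = measure (\<kappa> \<omega>) B"
        using elim(3,4) by (simp add: real_cond_exp_def ennreal_indicator)
      then have "nn_cond_exp M H (\<lambda>\<omega>. indicator B (X \<omega>)) \<omega> = emeasure (\<kappa> \<omega>) B"
        using fin by (metis \<kappa>.emeasure_eq_measure ennreal_enn2real)
      also have "\<dots> = (\<integral>\<^sup>+ v. indicator B v \<partial>\<kappa> \<omega>)"
        by simp
      finally show ?case .
    qed
  next
    case (mult u k)
    note [measurable] = mult(2)
    have "AE \<omega> in M. k * nn_cond_exp M H (\<lambda>\<omega>. u (X \<omega>)) \<omega> = nn_cond_exp M H (\<lambda>\<omega>. k * u (X \<omega>)) \<omega>"
      by (rule nn_cond_exp_prod) auto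
    then show ?case
      using mult(4) by eventually_elim (simp add: nn_integral_cmult)
  next
    case (add u v)
    note [measurable] = \<open>u \<in> borel_measurable borel\<close> \<open>v \<in> borel_measurable borel\<close>
    have "AE \<omega> in M. nn_cond_exp M H (\<lambda>\<omega>. v (X \<omega>)) \<omega> + nn_cond_exp M H (\<lambda>\<omega>. u (X \<omega>)) \<omega>
        = nn_cond_exp M H (\<lambda>\<omega>. v (X \<omega>) + u (X \<omega>)) \<omega>"
      by (rule nn_cond_exp_sum) auto
    then show ?case
      using add.IH by eventually_elim (simp add: nn_integral_add)
  next
    case (seq U)
    note [measurable] = seq(1)
    let ?N = "\<lambda>i. nn_cond_exp M H (\<lambda>\<omega>. U i (X \<omega>))"
    have mono: "U i v \<le> U (Suc i) v" for i v
      using \<open>incseq U\<close> by (simp add: incseq_Suc_iff le_fun_def)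
    have inc: "AE \<omega> in M. \<forall>i. ?N i \<omega> \<le> ?N (Suc i) \<omega>"
      unfolding AE_all_countable by (intro allI nn_cond_exp_mono) (auto simp: mono)
    have "AE \<omega> in M. (SUP i. ?N i \<omega>) = nn_cond_exp M H (\<lambda>\<omega>. SUP i. U i (X \<omega>)) \<omega>"
    proof (rule nn_cond_exp_charact)
      fix B
      assume B [measurable]: "B \<in> sets H"
      have [measurable]: "B \<in> sets M" using B subalg by (auto simp: subalgebra_def)
      have "(\<integral>\<^sup>+\<omega>\<in>B. (SUP i. U i (X \<omega>)) \<partial>M) = (\<integral>\<^sup>+\<omega>. (SUP i. indicator B \<omega> * U i (X \<omega>)) \<partial>M)"
        by (simp add: SUP_mult_left_ennreal mult.commute)
      also have "\<dots> = (SUP i. \<integral>\<^sup>+\<omega>. indicator B \<omega> * U i (X \<omega>) \<partial>M)"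
        by (rule nn_integral_monotone_convergence_SUP)
          (auto simp: incseq_Suc_iff le_fun_def intro!: mult_left_mono mono)
      also have "\<dots> = (SUP i. \<integral>\<^sup>+\<omega>. indicator B \<omega> * ?N i \<omega> \<partial>M)"
        by (subst nn_cond_exp_intg) auto
      also have "\<dots> = (\<integral>\<^sup>+\<omega>. (SUP i. indicator B \<omega> * ?N i \<omega>) \<partial>M)"
      proof (rule nn_integral_monotone_convergence_SUP_AE[symmetric])
        show "AE \<omega> in M. indicator B \<omega> * ?N i \<omega> \<le> indicator B \<omega> * ?N (Suc i) \<omega>" for i
          using inc by eventually_elim (auto intro: mult_left_mono)
      qed measurable
      also have "\<dots> = (\<integral>\<^sup>+\<omega>\<in>B. (SUP i. ?N i \<omega>) \<partial>M)"
        by (simp add: SUP_mult_left_ennreal mult.commute)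
      finally show "(\<integral>\<^sup>+\<omega>\<in>B. (SUP i. U i (X \<omega>)) \<partial>M) = (\<integral>\<^sup>+\<omega>\<in>B. (SUP i. ?N i \<omega>) \<partial>M)" .
    qed auto
    moreover have "AE \<omega> in M. \<forall>i. ?N i \<omega> = (\<integral>\<^sup>+ v. U i v \<partial>\<kappa> \<omega>)"
      unfolding AE_all_countable by (intro allI seq.IH)
    ultimately show ?case
    proof eventually_elim
      case (elim \<omega>)
      have "(\<integral>\<^sup>+ v. (SUP i. U i v) \<partial>\<kappa> \<omega>) = (SUP i. \<integral>\<^sup>+ v. U i v \<partial>\<kappa> \<omega>)"
        by (rule nn_integral_monotone_convergence_SUP[OF \<open>incseq U\<close>]) measurable
      with elim show ?case by (simp add: image_comp)
    qed
  }
qed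

text \<open>
  Square integrability of \<open>f (X \<omega>)\<close> is a conclusion: the conditional second moment is
  bounded by \<open>C\<close>, hence so is the second moment itself.
\<close>

lemma cond_exp_kernel_square_integrable:
  fixes X :: "'w \<Rightarrow> 'b::topological_space" and f :: "'b \<Rightarrow> real"
  assumes "prob_space M" "subalgebra M H"
    and X [measurable]: "X \<in> borel_measurable M"
    and \<kappa>: "\<And>\<omega>. prob_space (\<kappa> \<omega>)" "\<And>\<omega>. sets (\<kappa> \<omega>) = sets borel"
    and law: "\<And>B. B \<in> sets borel \<Longrightarrow>
      AE \<omega> in M. real_cond_exp M H (\<lambda>\<omega>. indicator B (X \<omega>)) \<omega> = measure (\<kappa> \<omega>) B"
    and f [measurable]: "f \<in> borel_measurable borel"
    and int: "\<And>\<omega>. integrable (\<kappa> \<omega>) f"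
    and C: "\<And>\<omega>. (\<integral>\<^sup>+ v. ennreal ((f v)\<^sup>2) \<partial>\<kappa> \<omega>) \<le> ennreal C" "0 \<le> C"
  shows "integrable M (\<lambda>\<omega>. (f (X \<omega>))\<^sup>2)" "(\<integral>\<omega>. (f (X \<omega>))\<^sup>2 \<partial>M) \<le> C"
    and "AE \<omega> in M. real_cond_exp M H (\<lambda>\<omega>. f (X \<omega>)) \<omega> = (\<integral>v. f v \<partial>\<kappa> \<omega>)"
proof -
  interpret prob_space M by fact
  interpret finite_measure_subalgebra M H
    by unfold_locales fact
  have kernel: "AE \<omega> in M. nn_cond_exp M H (\<lambda>\<omega>. \<phi> (X \<omega>)) \<omega> = (\<integral>\<^sup>+ v. \<phi> v \<partial>\<kappa> \<omega>)"
    if "\<phi> \<in> borel_measurable borel" for \<phi>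
    by (rule nn_cond_exp_kernel[OF assms(1-2) X \<kappa> _ that]) (rule law)
  have "(\<integral>\<^sup>+\<omega>. ennreal ((f (X \<omega>))\<^sup>2) \<partial>M) = (\<integral>\<^sup>+\<omega>. nn_cond_exp M H (\<lambda>\<omega>. ennreal ((f (X \<omega>))\<^sup>2)) \<omega> \<partial>M)"
    using nn_cond_exp_intg[of "\<lambda>_. 1" "\<lambda>\<omega>. ennreal ((f (X \<omega>))\<^sup>2)"] by simp
  also have "\<dots> \<le> (\<integral>\<^sup>+\<omega>. ennreal C \<partial>M)"
  proof (rule nn_integral_mono_AE)
    have "AE \<omega> in M. nn_cond_exp M H (\<lambda>\<omega>. ennreal ((f (X \<omega>))\<^sup>2)) \<omega> = (\<integral>\<^sup>+ v. ennreal ((f v)\<^sup>2) \<partial>\<kappa> \<omega>)"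
      by (rule kernel) measurable
    then show "AE \<omega> in M. nn_cond_exp M H (\<lambda>\<omega>. ennreal ((f (X \<omega>))\<^sup>2)) \<omega> \<le> ennreal C"
      by eventually_elim (simp add: C)
  qed
  also have "\<dots> = ennreal C" by (simp add: emeasure_space_1)
  finally have le: "(\<integral>\<^sup>+\<omega>. ennreal ((f (X \<omega>))\<^sup>2) \<partial>M) \<le> ennreal C" .
  show *: "integrable M (\<lambda>\<omega>. (f (X \<omega>))\<^sup>2)"
    using le by (intro integrableI_nonneg) (auto intro: le_less_trans)
  show "(\<integral>\<omega>. (f (X \<omega>))\<^sup>2 \<partial>M) \<le> C"
    using le C(2) by (subst (asm) nn_integral_eq_integral[OF *]) auto
  have "AE \<omega> in M. nn_cond_exp M H (\<lambda>\<omega>. ennreal (f (X \<omega>))) \<omega> = (\<integral>\<^sup>+ v. ennreal (f v) \<partial>\<kappa> \<omega>)"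
    by (rule kernel) measurable
  moreover have "AE \<omega> in M. nn_cond_exp M H (\<lambda>\<omega>. ennreal (- f (X \<omega>))) \<omega> = (\<integral>\<^sup>+ v. ennreal (- f v) \<partial>\<kappa> \<omega>)"
    by (rule kernel) measurable
  ultimately show "AE \<omega> in M. real_cond_exp M H (\<lambda>\<omega>. f (X \<omega>)) \<omega> = (\<integral>v. f v \<partial>\<kappa> \<omega>)"
    by eventually_elim (simp add: real_cond_exp_def real_lebesgue_integral_def[OF int])
qed

section \<open>Almost sure convergence of orthogonal noise\<close>

text \<open>
  Martingale differences \<open>x n\<close> with summable second moments. Orthogonality to bounded functions of the past
  suffices, because the proof only multiplies the differences by a sum that is stopped while it is small.
\<close>

locale square_summable_noise = prob_space M for M :: "'w measure" +
  fixes H :: "nat \<Rightarrow> 'w measure" and x :: "nat \<Rightarrow> 'w \<Rightarrow> real" and v :: "nat \<Rightarrow> real"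
  assumes filtration: "\<And>n. subalgebra M (H n)" "\<And>n. subalgebra (H (Suc n)) (H n)"
    and adapted: "\<And>n. x n \<in> borel_measurable (H (Suc n))"
    and square: "\<And>n. integrable M (\<lambda>\<omega>. (x n \<omega>)\<^sup>2)" "\<And>n. (\<integral>\<omega>. (x n \<omega>)\<^sup>2 \<partial>M) \<le> v n"
    and summable_v: "summable v"
    and orthogonal: "\<And>n \<phi> B. \<phi> \<in> borel_measurable (H n) \<Longrightarrow> (\<And>\<omega>. \<bar>\<phi> \<omega>\<bar> \<le> B) \<Longrightarrow>
      (\<integral>\<omega>. \<phi> \<omega> * x n \<omega> \<partial>M) = 0"
begin

lemma measurable_x [measurable]: "x n \<in> borel_measurable M"
  by (rule measurable_from_subalg[OF filtration(1) adapted])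

lemma integrable_x: "integrable M (x n)"
  by (rule square_integrable_imp_integrable[OF _ square(1)]) measurable

lemma v_nonneg: "0 \<le> v n"
  by (rule order_trans[OF _ square(2)]) simp

text \<open>
  The partial sums of \<open>x m, x (m + 1), \<dots>\<close>, frozen as soon as their modulus reaches \<open>\<epsilon>\<close>. A frozen sum
  keeps the record that the level was reached, so a maximal inequality for the partial sums becomes
  an inequality for one second moment.
\<close>

fun stopped :: "real \<Rightarrow> nat \<Rightarrow> nat \<Rightarrow> 'w \<Rightarrow> real" where
  "stopped \<epsilon> m 0 \<omega> = 0"
| "stopped \<epsilon> m (Suc k) \<omega> = stopped \<epsilon> m k \<omega> + (if \<bar>stopped \<epsilon> m k \<omega>\<bar> < \<epsilon> then x (m + k) \<omega> else 0)"

lemma measurable_stopped: "stopped \<epsilon> m k \<in> borel_measurable (H (m + k))"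
proof (induction k)
  case 0
  have "stopped \<epsilon> m 0 = (\<lambda>_. 0)" by (simp add: fun_eq_iff)
  then show ?case by simp
next
  case (Suc k)
  have [measurable]: "stopped \<epsilon> m k \<in> borel_measurable (H (Suc (m + k)))"
    by (rule measurable_from_subalg[OF filtration(2) Suc])
  note [measurable] = adapted
  have "stopped \<epsilon> m (Suc k) =
      (\<lambda>\<omega>. stopped \<epsilon> m k \<omega> + (if \<bar>stopped \<epsilon> m k \<omega>\<bar> < \<epsilon> then x (m + k) \<omega> else 0))"
    by (simp add: fun_eq_iff)
  then show ?case by simp
qed

lemma measurable_stopped' [measurable]: "stopped \<epsilon> m k \<in> borel_measurable M"
  by (rule measurable_from_subalg[OF filtration(1) measurable_stopped])

text \<open>
  The cross term \<open>2 * \<phi> * x\<close> has mean 0, since \<open>\<phi>\<close> is the stopped sum where it is still below \<open>\<epsilon>\<close>,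
  which is a bounded function of the past.
\<close>

lemma stopped_second_moment:
  assumes "0 < \<epsilon>"
  shows "integrable M (\<lambda>\<omega>. (stopped \<epsilon> m k \<omega>)\<^sup>2)
    \<and> (\<integral>\<omega>. (stopped \<epsilon> m k \<omega>)\<^sup>2 \<partial>M) \<le> (\<Sum>i<k. v (m + i))"
proof (induction k)
  case 0
  show ?case by simp
next
  case (Suc k)
  let ?T = "stopped \<epsilon> m k" and ?x = "x (m + k)"
  define \<phi> where "\<phi> \<omega> = (if \<bar>?T \<omega>\<bar> < \<epsilon> then ?T \<omega> else 0)" for \<omega>
  have \<phi>H: "\<phi> \<in> borel_measurable (H (m + k))"
    unfolding \<phi>_def[abs_def] using measurable_stopped[of \<epsilon> m k] by measurable
  have [measurable]: "\<phi> \<in> borel_measurable M"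
    by (rule measurable_from_subalg[OF filtration(1) \<phi>H])
  have \<phi>: "\<bar>\<phi> \<omega>\<bar> \<le> \<epsilon>" for \<omega> using assms by (simp add: \<phi>_def)
  have i1: "integrable M (\<lambda>\<omega>. \<phi> \<omega> * ?x \<omega>)"
  proof (rule Bochner_Integration.integrable_bound)
    show "integrable M (\<lambda>\<omega>. \<epsilon> * ?x \<omega>)" using integrable_x by simp
    show "AE \<omega> in M. norm (\<phi> \<omega> * ?x \<omega>) \<le> norm (\<epsilon> * ?x \<omega>)"
      using \<phi> assms by (auto simp: abs_mult intro!: mult_right_mono AE_I2)
  qed measurable
  have i2: "integrable M (\<lambda>\<omega>. if \<bar>?T \<omega>\<bar> < \<epsilon> then (?x \<omega>)\<^sup>2 else 0)"
    by (rule Bochner_Integration.integrable_bound[OF square(1)[of "m + k"]]) auto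
  have eq: "(\<lambda>\<omega>. (stopped \<epsilon> m (Suc k) \<omega>)\<^sup>2) =
      (\<lambda>\<omega>. (?T \<omega>)\<^sup>2 + 2 * (\<phi> \<omega> * ?x \<omega>) + (if \<bar>?T \<omega>\<bar> < \<epsilon> then (?x \<omega>)\<^sup>2 else 0))"
    by (auto simp: fun_eq_iff \<phi>_def power2_sum)
  have "(\<integral>\<omega>. (stopped \<epsilon> m (Suc k) \<omega>)\<^sup>2 \<partial>M) =
      (\<integral>\<omega>. (?T \<omega>)\<^sup>2 \<partial>M) + (\<integral>\<omega>. (if \<bar>?T \<omega>\<bar> < \<epsilon> then (?x \<omega>)\<^sup>2 else 0) \<partial>M)"
    unfolding eq using Suc i1 i2 orthogonal[OF \<phi>H \<phi>] by simp
  also have "(\<integral>\<omega>. (if \<bar>?T \<omega>\<bar> < \<epsilon> then (?x \<omega>)\<^sup>2 else 0) \<partial>M) \<le> (\<integral>\<omega>. (?x \<omega>)\<^sup>2 \<partial>M)"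
    by (rule integral_mono[OF i2 square(1)]) simp
  also have "\<dots> \<le> v (m + k)" by (rule square(2))
  finally have "(\<integral>\<omega>. (stopped \<epsilon> m (Suc k) \<omega>)\<^sup>2 \<partial>M) \<le> (\<Sum>i<Suc k. v (m + i))"
    using Suc by simp
  moreover have "integrable M (\<lambda>\<omega>. (stopped \<epsilon> m (Suc k) \<omega>)\<^sup>2)"
    unfolding eq using Suc i1 i2 by simp
  ultimately show ?case by simp
qed

abbreviation drifted :: "real \<Rightarrow> nat \<Rightarrow> nat \<Rightarrow> 'w \<Rightarrow> bool" where
  "drifted \<epsilon> m k \<omega> \<equiv> \<exists>j\<le>k. \<epsilon> \<le> \<bar>\<Sum>i<j. x (m + i) \<omega>\<bar>"

lemma stopped_if_drifted:
  assumes "drifted \<epsilon> m k \<omega>"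
  shows "\<epsilon> \<le> \<bar>stopped \<epsilon> m k \<omega>\<bar>"
proof -
  let ?S = "\<lambda>j. \<Sum>i<j. x (m + i) \<omega>"
  define j where "j = (LEAST j. \<epsilon> \<le> \<bar>?S j\<bar>)"
  obtain j' where j': "j' \<le> k" "\<epsilon> \<le> \<bar>?S j'\<bar>" using assms by blast
  have j: "\<epsilon> \<le> \<bar>?S j\<bar>" "j \<le> k"
    unfolding j_def by (rule LeastI, rule j', rule order_trans[OF Least_le j'(1)], rule j')
  have before: "\<bar>?S i\<bar> < \<epsilon>" if "i < j" for i
    using not_less_Least[OF that[unfolded j_def]] by simp
  have "stopped \<epsilon> m i \<omega> = ?S i" if "i \<le> j" for i
    using that
  proof (induction i)
    case (Suc i)
    with before[of i] show ?case by simp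
  qed simp
  with j(1) have "\<epsilon> \<le> \<bar>stopped \<epsilon> m j \<omega>\<bar>" by simp
  with j(2) show ?thesis
    by (induction k rule: dec_induct) auto
qed

text \<open>
  Kolmogorov's inequality, from Chebyshev's inequality for the stopped sum.
\<close>

lemma maximal_inequality:
  assumes "0 < \<epsilon>"
  shows "prob {\<omega> \<in> space M. \<exists>j. \<epsilon> \<le> \<bar>\<Sum>i<j. x (m + i) \<omega>\<bar>} \<le> (\<Sum>i. v (m + i)) / \<epsilon>\<^sup>2"
proof -
  have fin: "prob {\<omega> \<in> space M. drifted \<epsilon> m k \<omega>} \<le> (\<Sum>i. v (m + i)) / \<epsilon>\<^sup>2" for k
  proof -
    let ?T = "stopped \<epsilon> m k"
    have "prob {\<omega> \<in> space M. drifted \<epsilon> m k \<omega>} \<le> prob {\<omega> \<in> space M. \<epsilon>\<^sup>2 \<le> (?T \<omega>)\<^sup>2}"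
    proof (rule finite_measure_mono)
      show "{\<omega> \<in> space M. drifted \<epsilon> m k \<omega>} \<subseteq> {\<omega> \<in> space M. \<epsilon>\<^sup>2 \<le> (?T \<omega>)\<^sup>2}"
        using stopped_if_drifted[where \<epsilon> = \<epsilon> and m = m and k = k] assms
        by (auto simp: abs_le_square_iff[symmetric])
    qed measurable
    also have "\<dots> \<le> (\<integral>\<omega>. (?T \<omega>)\<^sup>2 \<partial>M) / \<epsilon>\<^sup>2"
      using stopped_second_moment[OF assms, of m k] assms
      by (intro integral_Markov_inequality_measure[where A = "space M"]) auto
    also have "\<dots> \<le> (\<Sum>i<k. v (m + i)) / \<epsilon>\<^sup>2"
      using stopped_second_moment[OF assms, of m k] by (intro divide_right_mono) auto
    also have "\<dots> \<le> (\<Sum>i. v (m + i)) / \<epsilon>\<^sup>2"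
      using summable_ignore_initial_segment[OF summable_v, of m]
      by (intro divide_right_mono sum_le_suminf) (auto simp: v_nonneg add.commute)
    finally show ?thesis .
  qed
  have "(\<lambda>k. prob {\<omega> \<in> space M. drifted \<epsilon> m k \<omega>}) \<longlonglongrightarrow> prob (\<Union>k. {\<omega> \<in> space M. drifted \<epsilon> m k \<omega>})"
    by (rule finite_Lim_measure_incseq) (auto simp: incseq_def intro: order_trans)
  moreover have "(\<Union>k. {\<omega> \<in> space M. drifted \<epsilon> m k \<omega>}) = {\<omega> \<in> space M. \<exists>j. \<epsilon> \<le> \<bar>\<Sum>i<j. x (m + i) \<omega>\<bar>}"
    by auto
  ultimately show ?thesis
    using fin by (intro LIMSEQ_le_const2) auto
qed

text \<open>
  The bounds in \<open>maximal_inequality\<close> are tails of a convergent series, so almost surely the partial sums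
  form a Cauchy sequence.
\<close>

lemma AE_convergent: "AE \<omega> in M. convergent (\<lambda>N. \<Sum>n<N. x n \<omega>)"
proof -
  have settle: "AE \<omega> in M. \<exists>m. \<forall>j. \<bar>\<Sum>i<j. x (m + i) \<omega>\<bar> < \<epsilon>" if \<epsilon>: "0 < \<epsilon>" for \<epsilon>
  proof -
    let ?B = "{\<omega> \<in> space M. \<forall>m. \<exists>j. \<epsilon> \<le> \<bar>\<Sum>i<j. x (m + i) \<omega>\<bar>}"
    have "prob ?B \<le> (\<Sum>i. v (m + i)) / \<epsilon>\<^sup>2" for m
      by (rule order_trans[OF finite_measure_mono maximal_inequality[OF \<epsilon>, of m]]) auto
    moreover have "(\<lambda>m. (\<Sum>i. v (m + i)) / \<epsilon>\<^sup>2) \<longlonglongrightarrow> 0 / \<epsilon>\<^sup>2"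
      using suminf_exist_split2[OF summable_v] \<epsilon> by (intro tendsto_divide) (auto simp: add.commute)
    ultimately have "prob ?B \<le> 0 / \<epsilon>\<^sup>2"
      by (intro LIMSEQ_le_const) auto
    then have "prob ?B = 0" by (simp add: measure_le_0_iff)
    then have "AE \<omega> in M. \<not> (\<forall>m. \<exists>j. \<epsilon> \<le> \<bar>\<Sum>i<j. x (m + i) \<omega>\<bar>)"
      by (subst AE_iff_measurable[where N = ?B]) (auto simp: emeasure_eq_measure)
    then show ?thesis by eventually_elim (auto simp: not_le)
  qed
  have "AE \<omega> in M. \<forall>n::nat. \<exists>m. \<forall>j. \<bar>\<Sum>i<j. x (m + i) \<omega>\<bar> < 1 / Suc n"
    unfolding AE_all_countable by (intro allI settle) simp
  then show ?thesis
  proof eventually_elim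
    case (elim \<omega>)
    have "Cauchy (\<lambda>N. \<Sum>n<N. x n \<omega>)"
    proof (rule metric_CauchyI)
      fix e :: real
      assume "0 < e"
      then obtain n where n: "1 / Suc n < e / 2"
        using nat_approx_posE[of "e / 2"] by auto
      obtain m where m: "\<And>j. \<bar>\<Sum>i<j. x (m + i) \<omega>\<bar> < 1 / Suc n" using elim by blast
      have split: "(\<Sum>i<N. x i \<omega>) = (\<Sum>i<m. x i \<omega>) + (\<Sum>i<N - m. x (m + i) \<omega>)" if "m \<le> N" for N
      proof -
        have "(\<Sum>i<m + n. x i \<omega>) = (\<Sum>i<m. x i \<omega>) + (\<Sum>i<n. x (m + i) \<omega>)" for n
          by (induction n) auto
        from this[of "N - m"] that show ?thesis by simp
      qed
      have "dist (\<Sum>i<N. x i \<omega>) (\<Sum>i<N'. x i \<omega>) < e" if "m \<le> N" "m \<le> N'" for N N'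
        using m[of "N - m"] m[of "N' - m"] n unfolding split[OF that(1)] split[OF that(2)] dist_real_def by linarith
      then show "\<exists>M. \<forall>m\<ge>M. \<forall>n\<ge>M. dist (\<Sum>i<m. x i \<omega>) (\<Sum>i<n. x i \<omega>) < e" by blast
    qed
    then show ?case by (simp add: Cauchy_convergent_iff)
  qed
qed

end

section \<open>Drift of the workload\<close>

lemma distr_pair_snd:
  assumes "prob_space M" "sigma_finite_measure N"
  shows "distr (M \<Otimes>\<^sub>M N) N snd = N"
proof (rule measure_eqI)
  interpret M: prob_space M by fact
  interpret N: sigma_finite_measure N by fact
  fix A
  assume "A \<in> sets (distr (M \<Otimes>\<^sub>M N) N snd)"
  then have A: "A \<in> sets N" by simp
  then have "snd -` A \<inter> space (M \<Otimes>\<^sub>M N) = space M \<times> A"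
    using sets.sets_into_space by (auto simp: space_pair_measure)
  then show "emeasure (distr (M \<Otimes>\<^sub>M N) N snd) A = emeasure N A"
    using A by (simp add: emeasure_distr N.emeasure_pair_measure_Times M.emeasure_space_1)
qed simp

lemma (in prob_space) integrable_lower_moments:
  fixes X :: "'a \<Rightarrow> real"
  assumes [measurable]: "X \<in> borel_measurable M"
    and "integrable M (\<lambda>x. X x ^ 4)" "k \<le> 4"
  shows "integrable M (\<lambda>x. X x ^ k)"
proof (rule Bochner_Integration.integrable_bound)
  show "integrable M (\<lambda>x. 1 + X x ^ 4)"
    using assms by simp
  have "norm (X x ^ k) \<le> norm (1 + X x ^ 4)" for x
  proof -
    have "\<bar>X x\<bar> ^ k \<le> 1 + \<bar>X x\<bar> ^ 4"
    proof (cases "\<bar>X x\<bar> \<le> 1")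
      case True
      then have "\<bar>X x\<bar> ^ k \<le> 1" by (simp add: power_le_one)
      then show ?thesis by (simp add: add_increasing2)
    next
      case False
      then show ?thesis
        using power_increasing[OF assms(3), of "\<bar>X x\<bar>"] by simp
    qed
    then show ?thesis by (simp add: power_abs)
  qed
  then show "AE x in M. norm (X x ^ k) \<le> norm (1 + X x ^ 4)" by simp
qed measurable

text \<open>
  For \<open>u\<close> the current load plus the shift \<open>r\<close>, and \<open>m, m2, m3, m4\<close> the first four moments of the net
  input, the bracketed polynomials are the expected second and fourth powers of the next \<open>u\<close>, for an
  unreflected random walk. As \<open>m < 0\<close>, they fall below \<open>u ^ 2\<close> and \<open>u ^ 4\<close> by multiples of \<open>u\<close> and \<open>u ^ 3\<close>
  once \<open>u\<close> is large. The shift makes every reachable \<open>u\<close> large, so the bounds need no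
  exceptional region near the empty state. The last inequality has the form needed in
  \<open>reward_second_moment\<close>.
\<close>

lemma quartic_drift_constants:
  fixes m m2 m3 m4 :: real
  assumes m: "m < 0"
  obtains r a A where "1 \<le> r" "0 < a" "0 < A"
    "\<And>u. r \<le> u \<Longrightarrow> a * (u ^ 2 + 2 * u * m + m2) + u \<le> a * u ^ 2"
    "\<And>u. r \<le> u \<Longrightarrow> A * (u ^ 4 + 4 * u ^ 3 * m + 6 * u ^ 2 * m2 + 4 * u * m3 + m4)
                      + 2 * u * (a * u ^ 2) + u ^ 2 \<le> A * u ^ 4"
proof -
  define n where "n = - m"
  have n: "0 < n" using m by (simp add: n_def)
  define B where "B = 6 * \<bar>m2\<bar> + 4 * \<bar>m3\<bar> + \<bar>m4\<bar>"
  have B: "0 \<le> B" by (simp add: B_def)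
  define A where "A = (2 / n + 1) / (3 * n)"
  have A: "0 < A" "3 * n * A = 2 / n + 1"
    using n by (auto simp: A_def intro!: divide_pos_pos add_pos_pos)
  show thesis
  proof (rule that[of "1 + B / n" "1 / n" A])
    fix u
    assume u: "1 + B / n \<le> u"
    have u1: "1 \<le> u" using u B n by (smt (verit) divide_nonneg_pos)
    have "B / n \<le> u" using u by simp
    then have Bu: "B \<le> n * u" using n by (simp add: field_simps)
    have m2: "m2 \<le> n * u" using Bu by (simp add: B_def)
    have "(1 / n) * (u ^ 2 + 2 * u * m + m2) + u = (1 / n) * u ^ 2 + (m2 - n * u) / n"
      using n by (simp add: field_simps n_def)
    also have "\<dots> \<le> (1 / n) * u ^ 2"
      using m2 n by (simp add: divide_nonpos_pos)
    finally show "(1 / n) * (u ^ 2 + 2 * u * m + m2) + u \<le> (1 / n) * u ^ 2" .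
    have p: "u \<le> u ^ 2" "1 \<le> u ^ 2" "u ^ 2 \<le> u ^ 3"
      using u1 power_increasing[of 1 2 u] power_increasing[of 0 2 u] power_increasing[of 2 3 u] by auto
    have "6 * u ^ 2 * m2 \<le> u ^ 2 * (6 * \<bar>m2\<bar>)"
      by (simp add: mult_left_mono)
    moreover have "4 * u * m3 \<le> u ^ 2 * (4 * \<bar>m3\<bar>)"
      using p u1 mult_mono[of u "u ^ 2" m3 "\<bar>m3\<bar>"] mult_mono[of u "u ^ 2" "\<bar>m3\<bar>" "\<bar>m3\<bar>"]
        mult_left_mono[of m3 "\<bar>m3\<bar>" u] by linarith
    moreover have "m4 \<le> u ^ 2 * \<bar>m4\<bar>"
      using mult_right_mono[OF p(2), of "\<bar>m4\<bar>"] by linarith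
    ultimately have "6 * u ^ 2 * m2 + 4 * u * m3 + m4 \<le> u ^ 2 * B"
      unfolding B_def by (simp only: distrib_left)
    also have "\<dots> \<le> u ^ 2 * (n * u)"
      using Bu by (intro mult_left_mono) auto
    finally have "6 * u ^ 2 * m2 + 4 * u * m3 + m4 \<le> n * u ^ 3"
      by (simp add: power3_eq_cube power2_eq_square mult_ac)
    then have "A * (4 * u ^ 3 * m + (6 * u ^ 2 * m2 + 4 * u * m3 + m4)) \<le> A * (4 * u ^ 3 * m + n * u ^ 3)"
      using A(1) by simp
    also have "\<dots> = - ((3 * n * A) * u ^ 3)"
      by (simp add: n_def algebra_simps)
    also have "\<dots> = - (2 * u * ((1 / n) * u ^ 2) + u ^ 3)"
      unfolding A(2) by (simp add: algebra_simps power3_eq_cube power2_eq_square)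
    finally show "A * (u ^ 4 + 4 * u ^ 3 * m + 6 * u ^ 2 * m2 + 4 * u * m3 + m4)
                      + 2 * u * ((1 / n) * u ^ 2) + u ^ 2 \<le> A * u ^ 4"
      using p(3) by (simp add: distrib_left)
  qed (use n A B in auto)
qed

text \<open>
  The maximum, not the sum: it is dominated by the workload of a single server that
  receives all customers, because a customer who starts at the idle Server 1 adds nothing to Server 2.
\<close>

definition load :: "real \<times> real \<Rightarrow> real" where
  "load x = max \<bar>fst x\<bar> \<bar>snd x\<bar>"

lemma load_nonneg: "0 \<le> load x"
  by (simp add: load_def le_max_iff_disj)

lemma load_eq_0_iff: "load x = 0 \<longleftrightarrow> x = (0, 0)"
  by (cases x) (auto simp: load_def max_def)

text \<open>
  Lindley's recursion for a single queue that gets every service requirement dominates the load under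
  any routing. The sensing decision has disappeared from the bound, which makes the
  later moment bounds uniform over strategies.
\<close>

lemma load_next_state:
  assumes "0 \<le> y" "0 \<le> t"
  shows "load (next_state x (s, y, t)) \<le> max 0 (load x + y - t)"
  using assms by (auto simp: load_def next_state_def split_beta max_def split: if_splits)

locale stable_queue =
  fixes lam mu :: real and F :: "real measure"
  assumes lam_pos: "0 < lam"
    and prob_F: "prob_space F" and sets_F: "sets F = sets borel" and F_nonneg: "AE y in F. 0 \<le> y"
    and F_integrable: "integrable F (\<lambda>y. y)" and F_mean: "(\<integral>y. y \<partial>F) = 1 / mu"
    and stability: "lam < mu"
    and F_moment4: "integrable F (\<lambda>y. y ^ 4)"
begin

abbreviation Exp :: "real measure" where
  "Exp \<equiv> density lborel (exponential_density lam)"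

sublocale F: prob_space F by (rule prob_F)
sublocale Exp: prob_space Exp by (rule prob_space_exponential_density[OF lam_pos])
sublocale FE: pair_prob_space F Exp ..

lemma measurable_F_cong [measurable_cong]: "sets F = sets borel"
  by (rule sets_F)

lemma Exp_power:
  "integrable Exp (\<lambda>t. t ^ k)" "(\<integral>t. t ^ k \<partial>Exp) = fact k / lam ^ k"
proof -
  have "distr Exp lborel (\<lambda>t. t) = distr Exp Exp (\<lambda>t. t)"
    by (rule distr_cong) auto
  then have D: "distributed Exp lborel (\<lambda>t. t) (erlang_density 0 lam)"
    by (auto simp: distributed_def)
  show "integrable Exp (\<lambda>t. t ^ k)"
    by (rule Exp.erlang_ith_moment_integrable[OF lam_pos D])
  show "(\<integral>t. t ^ k \<partial>Exp) = fact k / lam ^ k"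
    using Exp.erlang_ith_moment[OF lam_pos D, of k] by simp
qed

lemma Exp_nonneg: "AE t in Exp. 0 \<le> t"
  by (subst AE_density) (auto simp: exponential_density_def)

lemma integrable_FE_fst:
  fixes f :: "real \<Rightarrow> real"
  assumes "integrable F f"
  shows "integrable (F \<Otimes>\<^sub>M Exp) (\<lambda>z. f (fst z))" "(\<integral>z. f (fst z) \<partial>(F \<Otimes>\<^sub>M Exp)) = (\<integral>y. f y \<partial>F)"
  using integrable_distr_eq[of fst "F \<Otimes>\<^sub>M Exp" F f] integral_distr[of fst "F \<Otimes>\<^sub>M Exp" F f] assms
  by (auto simp: Exp.distr_pair_fst)

lemma integrable_FE_snd:
  fixes f :: "real \<Rightarrow> real"
  assumes "integrable Exp f"
  shows "integrable (F \<Otimes>\<^sub>M Exp) (\<lambda>z. f (snd z))" "(\<integral>z. f (snd z) \<partial>(F \<Otimes>\<^sub>M Exp)) = (\<integral>y. f y \<partial>Exp)"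
proof -
  have *: "distr (F \<Otimes>\<^sub>M Exp) Exp snd = Exp"
    by (rule distr_pair_snd[OF prob_F Exp.sigma_finite_measure_axioms])
  have f: "f \<in> borel_measurable Exp" using assms by auto
  show "integrable (F \<Otimes>\<^sub>M Exp) (\<lambda>z. f (snd z))"
    by (rule integrable_distr[of _ _ Exp]) (use * assms in simp_all)
  show "(\<integral>z. f (snd z) \<partial>(F \<Otimes>\<^sub>M Exp)) = (\<integral>y. f y \<partial>Exp)"
    using integral_distr[of snd "F \<Otimes>\<^sub>M Exp" Exp f] f * by simp
qed

lemma FE_nonneg: "AE z in F \<Otimes>\<^sub>M Exp. 0 \<le> fst z \<and> 0 \<le> snd z"
proof -
  have 1: "AE z in F \<Otimes>\<^sub>M Exp. 0 \<le> fst z"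
    by (rule AE_distrD[where M' = F and P = "\<lambda>y. 0 \<le> y"])
      (simp, subst Exp.distr_pair_fst, rule F_nonneg)
  have 2: "AE z in F \<Otimes>\<^sub>M Exp. 0 \<le> snd z"
    by (rule AE_distrD[where M' = Exp and P = "\<lambda>y. 0 \<le> y"])
      (simp, subst distr_pair_snd[OF prob_F Exp.sigma_finite_measure_axioms], rule Exp_nonneg)
  from 1 2 show ?thesis by eventually_elim simp
qed

abbreviation net :: "real \<times> real \<Rightarrow> real" where
  "net z \<equiv> fst z - snd z"

lemma integrable_net_power:
  assumes "k \<le> 4"
  shows "integrable (F \<Otimes>\<^sub>M Exp) (\<lambda>z. net z ^ k)"
proof (rule FE.integrable_lower_moments[OF _ _ assms])
  show "integrable (F \<Otimes>\<^sub>M Exp) (\<lambda>z. net z ^ 4)"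
  proof (rule Bochner_Integration.integrable_bound)
    show "integrable (F \<Otimes>\<^sub>M Exp) (\<lambda>z. 8 * fst z ^ 4 + 8 * snd z ^ 4)"
      using integrable_FE_fst(1)[OF F_moment4] integrable_FE_snd(1)[OF Exp_power(1)[of 4]] by simp
    have "(a - b) ^ 4 \<le> 8 * a ^ 4 + 8 * b ^ 4" for a b :: real
    proof -
      have sq: "(c - d)\<^sup>2 \<le> 2 * c\<^sup>2 + 2 * d\<^sup>2" "(c + d)\<^sup>2 \<le> 2 * c\<^sup>2 + 2 * d\<^sup>2" for c d :: real
        using zero_le_power2[of "c + d"] zero_le_power2[of "c - d"] by (simp_all add: power2_sum power2_diff)
      have "((a - b)\<^sup>2)\<^sup>2 \<le> (2 * a\<^sup>2 + 2 * b\<^sup>2)\<^sup>2"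
        using sq(1)[of a b] by (intro power_mono) auto
      also have "\<dots> \<le> 2 * (2 * a\<^sup>2)\<^sup>2 + 2 * (2 * b\<^sup>2)\<^sup>2" by (rule sq(2))
      finally show ?thesis by (simp add: power_mult_distrib flip: power_mult)
    qed
    then show "AE z in F \<Otimes>\<^sub>M Exp. norm (net z ^ 4) \<le> norm (8 * fst z ^ 4 + 8 * snd z ^ 4)"
      by simp
  qed measurable
qed measurable

lemma mean_net_neg: "(\<integral>z. net z \<partial>(F \<Otimes>\<^sub>M Exp)) < 0"
proof -
  have E: "integrable Exp (\<lambda>t. t)" "(\<integral>t. t \<partial>Exp) = 1 / lam"
    using Exp_power[of 1] by simp_all
  have "(\<integral>z. net z \<partial>(F \<Otimes>\<^sub>M Exp)) = 1 / mu - 1 / lam"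
    using integrable_FE_fst[OF F_integrable] integrable_FE_snd[OF E(1)]
    by (simp add: F_mean E(2))
  also have "\<dots> < 0"
    using stability lam_pos by (simp add: field_simps)
  finally show ?thesis .
qed

lemma lyapunov_constants:
  obtains r a A where "1 \<le> r" "0 < a" "0 < A"
    "\<And>u. r \<le> u \<Longrightarrow> a * (\<integral>z. (u + net z) ^ 2 \<partial>(F \<Otimes>\<^sub>M Exp)) + u \<le> a * u ^ 2"
    "\<And>u. r \<le> u \<Longrightarrow> A * (\<integral>z. (u + net z) ^ 4 \<partial>(F \<Otimes>\<^sub>M Exp)) + 2 * u * (a * u ^ 2) + u ^ 2 \<le> A * u ^ 4"
proof -
  define m where "m k = (\<integral>z. net z ^ k \<partial>(F \<Otimes>\<^sub>M Exp))" for k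
  note int = integrable_net_power[of 1, simplified] integrable_net_power[of 2] integrable_net_power[of 3] integrable_net_power[of 4]
  have "(\<integral>z. (u + net z) ^ 2 \<partial>(F \<Otimes>\<^sub>M Exp)) = (\<integral>z. u ^ 2 + 2 * u * net z + net z ^ 2 \<partial>(F \<Otimes>\<^sub>M Exp))" for u
    by (intro Bochner_Integration.integral_cong) (auto simp: power2_sum)
  also have "\<dots> u = u ^ 2 + 2 * u * m 1 + m 2" for u
    using int by (simp add: m_def FE.prob_space)
  finally have e2: "(\<integral>z. (u + net z) ^ 2 \<partial>(F \<Otimes>\<^sub>M Exp)) = u ^ 2 + 2 * u * m 1 + m 2" for u .
  have p4: "(u + v) ^ 4 = u ^ 4 + 4 * u ^ 3 * v + 6 * u ^ 2 * v ^ 2 + 4 * u * v ^ 3 + v ^ 4" for u v :: real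
    by (simp add: algebra_simps power4_eq_xxxx power3_eq_cube power2_eq_square)
  have "(\<integral>z. (u + net z) ^ 4 \<partial>(F \<Otimes>\<^sub>M Exp)) = (\<integral>z. u ^ 4 + 4 * u ^ 3 * net z + 6 * u ^ 2 * net z ^ 2 + 4 * u * net z ^ 3 + net z ^ 4 \<partial>(F \<Otimes>\<^sub>M Exp))" for u
    by (intro Bochner_Integration.integral_cong p4) auto
  also have "\<dots> u = u ^ 4 + 4 * u ^ 3 * m 1 + 6 * u ^ 2 * m 2 + 4 * u * m 3 + m 4" for u
    using int by (simp add: m_def FE.prob_space)
  finally have e4: "(\<integral>z. (u + net z) ^ 4 \<partial>(F \<Otimes>\<^sub>M Exp)) = u ^ 4 + 4 * u ^ 3 * m 1 + 6 * u ^ 2 * m 2 + 4 * u * m 3 + m 4" for u .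
  have "m 1 < 0" using mean_net_neg by (simp add: m_def)
  from quartic_drift_constants[OF this, of "m 2" "m 3" "m 4"] that show thesis
    unfolding e2 e4 by blast
qed

end

section \<open>Rewards over a regeneration cycle\<close>

type_synonym input = "bool \<times> real \<times> real"

text \<open>
  The states \<open>seen\<close> from an arbitrary starting state. First-step analysis restarts the process
  after one transition, away from the empty state.
\<close>

primrec trajectory :: "real \<times> real \<Rightarrow> (nat \<Rightarrow> input) \<Rightarrow> nat \<Rightarrow> real \<times> real" where
  "trajectory x z 0 = x"
| "trajectory x z (Suc k) = next_state (trajectory x z k) (z k)"

lemma trajectory_empty: "trajectory (0, 0) z = seen z"
proof
  fix k show "trajectory (0, 0) z k = seen z k" by (induction k) auto
qed

lemma trajectory_Suc_shift: "trajectory x z (Suc k) = trajectory (next_state x (z 0)) (\<lambda>i. z (Suc i)) k"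
  by (induction k) auto

definition unreturned :: "nat \<Rightarrow> real \<times> real \<Rightarrow> (nat \<Rightarrow> input) \<Rightarrow> bool" where
  "unreturned k x z \<longleftrightarrow> (\<forall>i\<in>{1..k}. trajectory x z i \<noteq> (0, 0))"

text \<open>
  The reward collected at step \<open>k\<close> of an excursion, which is lost once the empty state has been revisited.
  Summed over all \<open>k\<close> it is the total reward of a cycle, without mentioning the cycle length.
\<close>

definition reward :: "(real \<times> real \<Rightarrow> ennreal) \<Rightarrow> nat \<Rightarrow> real \<times> real \<Rightarrow> (nat \<Rightarrow> input) \<Rightarrow> ennreal" where
  "reward f k x z = (if unreturned k x z then f (trajectory x z k) else 0)"

lemma unreturned_Suc:
  "unreturned (Suc k) x z \<longleftrightarrow>
     next_state x (z 0) \<noteq> (0, 0) \<and> unreturned k (next_state x (z 0)) (\<lambda>i. z (Suc i))"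
proof -
  have *: "{1..Suc k} = insert 1 (Suc ` {1..k})"
    by (auto simp: image_Suc_atLeastAtMost)
  have **: "(\<forall>i\<in>insert 1 (Suc ` {1..k}). R i) \<longleftrightarrow> R (Suc 0) \<and> (\<forall>i\<in>{1..k}. R (Suc i))" for R :: "nat \<Rightarrow> bool"
    unfolding One_nat_def by blast
  show ?thesis
    unfolding unreturned_def * ** trajectory_Suc_shift trajectory.simps(1) ..
qed

lemma reward_0 [simp]: "reward f 0 x z = f x"
  by (simp add: reward_def unreturned_def)

lemma reward_Suc:
  "reward f (Suc k) x z =
     (if next_state x (z 0) = (0, 0) then 0
      else reward f k (next_state x (z 0)) (\<lambda>i. z (Suc i)))"
  unfolding reward_def unreturned_Suc trajectory_Suc_shift by simp

abbreviation (input) input_space :: "input measure" where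
  "input_space \<equiv> count_space UNIV \<Otimes>\<^sub>M (borel \<Otimes>\<^sub>M borel)"

abbreviation (input) state_space :: "(real \<times> real) measure" where
  "state_space \<equiv> borel"

lemma measurable_state_cong [measurable_cong]: "sets state_space = sets (borel \<Otimes>\<^sub>M borel)"
  by (rule arg_cong[OF borel_prod[symmetric]])

lemma measurable_next_state [measurable]:
  "(\<lambda>(x, z). next_state x z) \<in> state_space \<Otimes>\<^sub>M input_space \<rightarrow>\<^sub>M state_space"
  unfolding next_state_def split_beta' by measurable

lemma measurable_next_state' [measurable (raw)]:
  assumes [measurable]: "f \<in> M \<rightarrow>\<^sub>M state_space" "g \<in> M \<rightarrow>\<^sub>M input_space"
  shows "(\<lambda>x. next_state (f x) (g x)) \<in> M \<rightarrow>\<^sub>M state_space"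
  using measurable_compose[OF measurable_Pair[OF assms] measurable_next_state] by simp

lemma measurable_trajectory [measurable (raw)]:
  assumes [measurable]: "f \<in> M \<rightarrow>\<^sub>M state_space" "g \<in> M \<rightarrow>\<^sub>M (\<Pi>\<^sub>M (_::nat)\<in>UNIV. input_space)"
  shows "(\<lambda>w. trajectory (f w) (g w) k) \<in> M \<rightarrow>\<^sub>M state_space"
proof (induction k)
  case 0
  show ?case by simp
next
  case (Suc k)
  note [measurable] = Suc
  show ?case by simp
qed

lemma measurable_reward [measurable (raw)]:
  assumes [measurable]: "\<phi> \<in> borel_measurable state_space"
    "f \<in> M \<rightarrow>\<^sub>M state_space" "g \<in> M \<rightarrow>\<^sub>M (\<Pi>\<^sub>M (_::nat)\<in>UNIV. input_space)"
  shows "(\<lambda>w. reward \<phi> k (f w) (g w)) \<in> borel_measurable M"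
  unfolding reward_def unreturned_def by measurable

lemma measurable_load [measurable]: "load \<in> borel_measurable state_space"
  unfolding load_def[abs_def] by measurable

text \<open>
  The constants are parameters, so that one choice serves all strategies \<open>p\<close>.
\<close>

locale routed_queue = stable_queue +
  fixes p :: "real \<times> real" and r a A :: real
  assumes constants: "1 \<le> r" "0 < a" "0 < A"
    and quadratic_drift: "\<And>u. r \<le> u \<Longrightarrow>
      a * (\<integral>z. (u + net z) ^ 2 \<partial>(F \<Otimes>\<^sub>M Exp)) + u \<le> a * u ^ 2"
    and quartic_drift: "\<And>u. r \<le> u \<Longrightarrow>
      A * (\<integral>z. (u + net z) ^ 4 \<partial>(F \<Otimes>\<^sub>M Exp)) + 2 * u * (a * u ^ 2) + u ^ 2 \<le> A * u ^ 4"
begin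

abbreviation I :: "input measure" where
  "I \<equiv> input_law lam F p"

abbreviation inputs :: "(nat \<Rightarrow> input) measure" where
  "inputs \<equiv> \<Pi>\<^sub>M (_::nat)\<in>UNIV. I"

sublocale I: prob_space I
proof -
  interpret pair_prob_space "measure_pmf (bernoulli_pmf (fst p))" "F \<Otimes>\<^sub>M Exp" ..
  show "prob_space I"
    unfolding input_law_def by unfold_locales
qed

sublocale seq: sequence_space I ..

lemma sets_I [measurable_cong]: "sets I = sets input_space"
  unfolding input_law_def by (intro sets_pair_measure_cong) (auto simp: sets_F)

lemma sets_inputs [measurable_cong]: "sets inputs = sets (\<Pi>\<^sub>M (_::nat)\<in>UNIV. input_space)"
  by (intro sets_PiM_cong sets_I refl)

lemma distr_I: "distr I (F \<Otimes>\<^sub>M Exp) snd = F \<Otimes>\<^sub>M Exp"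
  unfolding input_law_def
  by (rule distr_pair_snd) (auto intro: measure_pmf.prob_space_axioms FE.sigma_finite_measure_axioms)

lemma measurable_snd_I: "snd \<in> I \<rightarrow>\<^sub>M F \<Otimes>\<^sub>M Exp"
  unfolding input_law_def by simp

lemma I_nonneg: "AE z in I. 0 \<le> fst (snd z) \<and> 0 \<le> snd (snd z)"
  by (rule AE_distrD[OF measurable_snd_I, where P = "\<lambda>z. 0 \<le> fst z \<and> 0 \<le> snd z"])
    (subst distr_I, rule FE_nonneg)

text \<open>
  Transition operator of the state process, killed on its return to the empty state.
\<close>

definition Q :: "(real \<times> real \<Rightarrow> ennreal) \<Rightarrow> real \<times> real \<Rightarrow> ennreal" where
  "Q f x = (\<integral>\<^sup>+ z. (if next_state x z = (0, 0) then 0 else f (next_state x z)) \<partial>I)"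

lemma measurable_Q [measurable]:
  assumes [measurable]: "f \<in> borel_measurable state_space"
  shows "Q f \<in> borel_measurable state_space"
  unfolding Q_def[abs_def] by measurable

lemma measurable_Q_funpow [measurable]:
  "f \<in> borel_measurable state_space \<Longrightarrow> (Q ^^ k) f \<in> borel_measurable state_space"
  by (induction k) (auto intro: measurable_Q)

lemma Q_mono: "(\<And>x. f x \<le> h x) \<Longrightarrow> Q f x \<le> Q h x"
  unfolding Q_def by (intro nn_integral_mono) auto

lemma Q_add:
  assumes [measurable]: "f \<in> borel_measurable state_space" "h \<in> borel_measurable state_space"
  shows "Q (\<lambda>x. f x + h x) = (\<lambda>x. Q f x + Q h x)"
proof
  fix x
  show "Q (\<lambda>x. f x + h x) x = Q f x + Q h x"
    unfolding Q_def by (subst nn_integral_add[symmetric]) (auto intro!: nn_integral_cong)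
qed

lemma Q_sum:
  fixes n :: nat
  assumes [measurable]: "\<And>k. f k \<in> borel_measurable state_space"
  shows "Q (\<lambda>x. \<Sum>k<n. f k x) = (\<lambda>x. \<Sum>k<n. Q (f k) x)"
proof (induction n)
  case 0
  show ?case by (auto simp: Q_def fun_eq_iff)
next
  case (Suc n)
  then show ?case by (simp add: Q_add)
qed

lemma Q_funpow_add:
  assumes [measurable]: "f \<in> borel_measurable state_space" "h \<in> borel_measurable state_space"
  shows "(Q ^^ k) (\<lambda>x. f x + h x) = (\<lambda>x. (Q ^^ k) f x + (Q ^^ k) h x)"
  by (induction k) (auto simp: Q_add)

lemma nn_integral_inputs_first:
  assumes [measurable]: "\<Phi> \<in> borel_measurable inputs"
  shows "(\<integral>\<^sup>+ z. \<Phi> z \<partial>inputs) = (\<integral>\<^sup>+ s. \<integral>\<^sup>+ z. \<Phi> (case_nat s z) \<partial>inputs \<partial>I)"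
proof -
  have m: "(\<lambda>(s, z). case_nat s z) \<in> I \<Otimes>\<^sub>M inputs \<rightarrow>\<^sub>M inputs"
    by measurable
  have "(\<integral>\<^sup>+ z. \<Phi> z \<partial>inputs) = (\<integral>\<^sup>+ z. \<Phi> z \<partial>distr (I \<Otimes>\<^sub>M inputs) inputs (\<lambda>(s, z). case_nat s z))"
    by (simp only: seq.PiM_iter)
  also have "\<dots> = (\<integral>\<^sup>+ (s, z). \<Phi> (case_nat s z) \<partial>(I \<Otimes>\<^sub>M inputs))"
    by (subst nn_integral_distr[OF m]) (auto simp: split_beta')
  also have "\<dots> = (\<integral>\<^sup>+ s. \<integral>\<^sup>+ z. \<Phi> (case_nat s z) \<partial>inputs \<partial>I)"
    by (subst seq.nn_integral_fst[symmetric]) auto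
  finally show ?thesis .
qed

lemma nn_integral_reward:
  assumes [measurable]: "f \<in> borel_measurable state_space"
  shows "(\<integral>\<^sup>+ z. reward f k x z \<partial>inputs) = (Q ^^ k) f x"
proof (induction k arbitrary: x)
  case 0
  show ?case by (simp add: seq.emeasure_space_1)
next
  case (Suc k)
  have "(\<integral>\<^sup>+ z. reward f (Suc k) x z \<partial>inputs) =
      (\<integral>\<^sup>+ s. \<integral>\<^sup>+ z. reward f (Suc k) x (case_nat s z) \<partial>inputs \<partial>I)"
    by (rule nn_integral_inputs_first) measurable
  also have "\<dots> = (\<integral>\<^sup>+ s. (if next_state x s = (0, 0) then 0 else (Q ^^ k) f (next_state x s)) \<partial>I)"
    by (intro nn_integral_cong) (simp add: reward_Suc Suc)
  finally show ?case by (simp add: Q_def[of "(Q ^^ k) f"])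
qed

text \<open>
  Killing spares the discussion of the boundary: a surviving transition has
  positive load, so the maximum with 0 in \<open>load_next_state\<close> is not active, and the load is bounded by that
  of an unreflected random walk. The power must be even to be nonnegative also where the walk is
  negative.
\<close>

lemma Q_load_power:
  assumes "even k" "k \<le> 4" "0 \<le> c"
  shows "Q (\<lambda>x. ennreal (c * (load x + r) ^ k)) x
           \<le> ennreal (c * (\<integral>z. (load x + r + net z) ^ k \<partial>(F \<Otimes>\<^sub>M Exp)))"
proof -
  let ?h = "\<lambda>z. ennreal (c * (load x + r + net z) ^ k)"
  have "Q (\<lambda>x. ennreal (c * (load x + r) ^ k)) x \<le> (\<integral>\<^sup>+ z. ?h (snd z) \<partial>I)"
    unfolding Q_def
  proof (rule nn_integral_mono_AE, use I_nonneg in eventually_elim)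
    case (elim z)
    obtain s y t where z: "z = (s, y, t)" by (cases z) auto
    show ?case
    proof (cases "next_state x z = (0, 0)")
      case False
      then have "load (next_state x z) > 0"
        using load_nonneg[of "next_state x z"] load_eq_0_iff[of "next_state x z"] by linarith
      then have "load (next_state x z) \<le> load x + y - t"
        using load_next_state[of y t x s] elim by (simp add: z)
      then have "(load (next_state x z) + r) ^ k \<le> (load x + r + net (snd z)) ^ k"
        using load_nonneg[of "next_state x z"] constants by (intro power_mono) (auto simp: z)
      then show ?thesis
        using False assms(3) by (auto intro!: ennreal_leI mult_left_mono)
    qed simp
  qed
  also have "\<dots> = (\<integral>\<^sup>+ z. ?h z \<partial>distr I (F \<Otimes>\<^sub>M Exp) snd)"
    by (subst nn_integral_distr[OF measurable_snd_I]) auto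
  also have "\<dots> = (\<integral>\<^sup>+ z. ?h z \<partial>(F \<Otimes>\<^sub>M Exp))"
    by (simp only: distr_I)
  also have "\<dots> = ennreal (\<integral>z. c * (load x + r + net z) ^ k \<partial>(F \<Otimes>\<^sub>M Exp))"
  proof (rule nn_integral_eq_integral)
    have "integrable (F \<Otimes>\<^sub>M Exp) (\<lambda>z. (\<Sum>i\<le>k. of_nat (k choose i) * (load x + r) ^ i * net z ^ (k - i)))"
      using assms(2) by (intro Bochner_Integration.integrable_sum integrable_mult_right integrable_net_power) auto
    then show "integrable (F \<Otimes>\<^sub>M Exp) (\<lambda>z. c * (load x + r + net z) ^ k)"
      by (simp add: binomial_ring[of "load x + r"])
  qed (use assms in \<open>auto simp: zero_le_even_power\<close>)
  finally show ?thesis by simp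
qed

abbreviation g :: "real \<times> real \<Rightarrow> ennreal" where
  "g \<equiv> \<lambda>x. ennreal (load x + r)"

abbreviation V2 :: "real \<times> real \<Rightarrow> ennreal" where
  "V2 \<equiv> \<lambda>x. ennreal (a * (load x + r) ^ 2)"

abbreviation V4 :: "real \<times> real \<Rightarrow> ennreal" where
  "V4 \<equiv> \<lambda>x. ennreal (A * (load x + r) ^ 4)"

lemma V2_drift: "Q V2 x + g x \<le> V2 x"
proof -
  let ?u = "load x + r"
  have u: "r \<le> ?u" "0 \<le> ?u" using load_nonneg[of x] constants by auto
  have i: "0 \<le> (\<integral>z. (?u + net z) ^ 2 \<partial>(F \<Otimes>\<^sub>M Exp))" by simp
  have "Q V2 x + g x \<le> ennreal (a * (\<integral>z. (?u + net z) ^ 2 \<partial>(F \<Otimes>\<^sub>M Exp))) + ennreal ?u"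
    using Q_load_power[of 2 a x] constants by (intro add_right_mono) auto
  also have "\<dots> = ennreal (a * (\<integral>z. (?u + net z) ^ 2 \<partial>(F \<Otimes>\<^sub>M Exp)) + ?u)"
    using u i constants by (subst ennreal_plus[symmetric]) auto
  also have "\<dots> \<le> V2 x"
    using quadratic_drift[OF u(1)] by (rule ennreal_leI)
  finally show ?thesis .
qed

lemma V4_drift: "(g x)\<^sup>2 + 2 * g x * V2 x + Q V4 x \<le> V4 x"
proof -
  let ?u = "load x + r"
  have u: "r \<le> ?u" "0 \<le> ?u" using load_nonneg[of x] constants by auto
  have i: "0 \<le> (\<integral>z. (?u + net z) ^ 4 \<partial>(F \<Otimes>\<^sub>M Exp))"
    by (intro Bochner_Integration.integral_nonneg zero_le_even_power) auto
  have sum: "(ennreal u)\<^sup>2 + 2 * ennreal u * ennreal (a * u\<^sup>2) + ennreal b = ennreal (u\<^sup>2 + 2 * u * (a * u\<^sup>2) + b)"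
    if "0 \<le> u" "0 \<le> b" for u b
    using that constants by (simp add: ennreal_plus ennreal_mult ennreal_power)
  have "(g x)\<^sup>2 + 2 * g x * V2 x + Q V4 x
      \<le> (g x)\<^sup>2 + 2 * g x * V2 x + ennreal (A * (\<integral>z. (?u + net z) ^ 4 \<partial>(F \<Otimes>\<^sub>M Exp)))"
    using Q_load_power[of 4 A x] constants by (intro add_left_mono) auto
  also have "\<dots> = ennreal (?u\<^sup>2 + 2 * ?u * (a * ?u\<^sup>2) + A * (\<integral>z. (?u + net z) ^ 4 \<partial>(F \<Otimes>\<^sub>M Exp)))"
    by (rule sum) (use u i constants in simp_all)
  also have "\<dots> \<le> V4 x"
    using quartic_drift[OF u(1)] by (intro ennreal_leI) linarith
  finally show ?thesis .
qed

text \<open>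
  Discrete comparison principle: a function \<open>V\<close> that decreases on average by at least \<open>f\<close> dominates the total
  expected reward \<open>f\<close> of an excursion.
\<close>

lemma Q_potential_le:
  assumes [measurable]: "f \<in> borel_measurable state_space"
    and f: "\<And>x. Q V x + f x \<le> V x"
  shows "(\<Sum>k<n. (Q ^^ k) f x) \<le> V x"
proof (induction n arbitrary: x)
  case 0
  show ?case by simp
next
  case (Suc n)
  have "(\<Sum>k<Suc n. (Q ^^ k) f x) = f x + Q (\<lambda>x. \<Sum>k<n. (Q ^^ k) f x) x"
    by (subst Q_sum) (auto simp: sum.lessThan_Suc_shift simp del: sum.lessThan_Suc)
  also have "\<dots> \<le> f x + Q V x"
    by (intro add_left_mono Q_mono Suc)
  finally show ?case
    using f[of x] by (simp add: add.commute order_trans)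
qed

text \<open>
  Split off the first step: the total \<open>S\<close> is \<open>g x\<close> plus the total after one step, so
  \<open>S\<^sup>2\<close> consists of \<open>(g x)\<^sup>2\<close>, a mixed term and the square of the later total. The expected later
  total is at most \<open>V2\<close>, and \<open>V4_drift\<close> is exactly what closes the induction.
\<close>

lemma reward_second_moment:
  "(\<integral>\<^sup>+ z. (\<Sum>k<n. reward g k x z)\<^sup>2 \<partial>inputs) \<le> V4 x"
proof (induction n arbitrary: x)
  case 0
  show ?case by simp
next
  case (Suc n)
  let ?S = "\<lambda>n x z. \<Sum>k<n. reward g k x z"
  have shift: "?S (Suc n) x (case_nat s z) =
      g x + (if next_state x s = (0, 0) then 0 else ?S n (next_state x s) z)" for s z
    by (simp add: sum.lessThan_Suc_shift reward_Suc del: sum.lessThan_Suc)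
  have first: "(\<integral>\<^sup>+ z. ?S n y z \<partial>inputs) \<le> V2 y" for y
    by (subst nn_integral_sum) (auto simp: nn_integral_reward intro!: Q_potential_le V2_drift)
  have inner: "(\<integral>\<^sup>+ z. (?S (Suc n) x (case_nat s z))\<^sup>2 \<partial>inputs) \<le>
      (g x)\<^sup>2 + 2 * g x * (if next_state x s = (0, 0) then 0 else V2 (next_state x s))
        + (if next_state x s = (0, 0) then 0 else V4 (next_state x s))" for s
  proof (cases "next_state x s = (0, 0)")
    case True
    then show ?thesis
      unfolding shift by (simp add: seq.emeasure_space_1)
  next
    case False
    let ?y = "next_state x s"
    have "(\<integral>\<^sup>+ z. (?S (Suc n) x (case_nat s z))\<^sup>2 \<partial>inputs) =
        (\<integral>\<^sup>+ z. (g x)\<^sup>2 + 2 * g x * ?S n ?y z + (?S n ?y z)\<^sup>2 \<partial>inputs)"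
      unfolding shift using False
      by (intro nn_integral_cong) (simp add: power2_eq_square algebra_simps mult_2)
    also have "\<dots> = (g x)\<^sup>2 + 2 * g x * (\<integral>\<^sup>+ z. ?S n ?y z \<partial>inputs) + (\<integral>\<^sup>+ z. (?S n ?y z)\<^sup>2 \<partial>inputs)"
      by (simp add: nn_integral_add nn_integral_cmult seq.emeasure_space_1)
    also have "\<dots> \<le> (g x)\<^sup>2 + 2 * g x * V2 ?y + V4 ?y"
      by (intro add_mono mult_left_mono first Suc) auto
    finally show ?thesis using False by simp
  qed
  have "(\<integral>\<^sup>+ z. (?S (Suc n) x z)\<^sup>2 \<partial>inputs) =
      (\<integral>\<^sup>+ s. \<integral>\<^sup>+ z. (?S (Suc n) x (case_nat s z))\<^sup>2 \<partial>inputs \<partial>I)"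
    by (rule nn_integral_inputs_first) measurable
  also have "\<dots> \<le> (\<integral>\<^sup>+ s. (g x)\<^sup>2 + 2 * g x * (if next_state x s = (0, 0) then 0 else V2 (next_state x s))
        + (if next_state x s = (0, 0) then 0 else V4 (next_state x s)) \<partial>I)"
    by (intro nn_integral_mono inner)
  also have "\<dots> = (g x)\<^sup>2 + 2 * g x * Q V2 x + Q V4 x"
    unfolding Q_def by (simp add: nn_integral_add nn_integral_cmult I.emeasure_space_1)
  also have "\<dots> \<le> (g x)\<^sup>2 + 2 * g x * V2 x + Q V4 x"
  proof (intro add_mono mult_left_mono order_refl)
    show "Q V2 x \<le> V2 x"
      using V2_drift[of x] by (rule order_trans[rotated]) simp
  qed auto
  also have "\<dots> \<le> V4 x" by (rule V4_drift)
  finally show ?case .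
qed

end

section \<open>The stationary law\<close>

lemma ennreal_suminf_tendsto_zero:
  fixes f :: "nat \<Rightarrow> ennreal"
  assumes "(\<Sum>k. f k) \<noteq> top"
  shows "f \<longlonglongrightarrow> 0"
proof -
  have "f k \<noteq> top" for k
    using sum_le_suminf[of f "{k}"] assms by (auto simp: top_unique)
  then have f: "f = (\<lambda>k. ennreal (enn2real (f k)))"
    by (simp add: less_top)
  have "summable (\<lambda>k. enn2real (f k))"
    by (rule summable_suminf_not_top) (use assms f in auto)
  then have "(\<lambda>k. ennreal (enn2real (f k))) \<longlonglongrightarrow> ennreal 0"
    by (intro tendsto_ennrealI summable_LIMSEQ_zero)
  then show ?thesis
    using f by simp
qed

context routed_queue
begin

lemma one_le_g: "1 \<le> g x"
proof -
  have "1 \<le> load x + r" using load_nonneg[of x] constants(1) by linarith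
  then have "ennreal 1 \<le> ennreal (load x + r)" by (rule ennreal_leI)
  then show ?thesis by simp
qed

lemma Q_funpow_mono: "(\<And>x. f x \<le> h x) \<Longrightarrow> (Q ^^ k) f x \<le> (Q ^^ k) h x"
  by (induction k arbitrary: x) (auto intro: Q_mono)

lemma suminf_Q_funpow_le:
  assumes [measurable]: "f \<in> borel_measurable state_space"
    and f: "\<And>x. Q V x + f x \<le> V x"
  shows "(\<Sum>k. (Q ^^ k) f x) \<le> V x"
  unfolding suminf_eq_SUP using Q_potential_le[OF assms] by (intro SUP_least)

text \<open>
  The probability that an excursion survives for \<open>k\<close> steps vanishes, as these probabilities have a finite
  sum, the mean length of the excursion.
\<close>

lemma Q_funpow_one_tendsto_0: "(\<lambda>k. (Q ^^ k) (\<lambda>_. 1) x) \<longlonglongrightarrow> 0"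
proof -
  have "(\<Sum>k. (Q ^^ k) (\<lambda>_. 1) x) \<le> (\<Sum>k. (Q ^^ k) g x)"
    by (intro suminf_le Q_funpow_mono one_le_g) auto
  also have "\<dots> \<le> V2 x"
    by (intro suminf_Q_funpow_le V2_drift) measurable
  finally have "(\<Sum>k. (Q ^^ k) (\<lambda>_. 1) x) \<noteq> top"
    by (auto simp: top_unique)
  then show ?thesis
    by (rule ennreal_suminf_tendsto_zero)
qed

text \<open>
  The expected total reward over one cycle, by \<open>nn_integral_reward\<close>.
\<close>

definition occupation :: "(real \<times> real \<Rightarrow> ennreal) \<Rightarrow> ennreal" where
  "occupation f = (\<Sum>k. (Q ^^ k) f (0, 0))"

abbreviation mean_length :: ennreal where
  "mean_length \<equiv> occupation (\<lambda>_. 1)"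

lemma occupation_g_le: "occupation g \<le> V2 (0, 0)"
  unfolding occupation_def by (intro suminf_Q_funpow_le V2_drift) measurable

lemma mean_length_bounds: "1 \<le> mean_length" "mean_length \<le> V2 (0, 0)"
proof -
  have "(\<Sum>k<1. (Q ^^ k) (\<lambda>_. 1) (0, 0)) \<le> mean_length"
    unfolding occupation_def by (rule sum_le_suminf) auto
  then show "1 \<le> mean_length" by simp
  have "mean_length \<le> occupation g"
    unfolding occupation_def by (intro suminf_le Q_funpow_mono one_le_g) auto
  then show "mean_length \<le> V2 (0, 0)"
    using occupation_g_le by (rule order_trans)
qed

lemma mean_length_finite: "mean_length \<noteq> 0" "mean_length \<noteq> top"
  using mean_length_bounds by (auto simp: top_unique)

text \<open>
  The probability that the next arrival finds an empty system.
\<close>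

definition emptying :: "real \<times> real \<Rightarrow> ennreal" where
  "emptying x = (\<integral>\<^sup>+ z. indicator {(0, 0)} (next_state x z) \<partial>I)"

lemma measurable_emptying [measurable]: "emptying \<in> borel_measurable state_space"
  unfolding emptying_def[abs_def] by measurable

lemma one_step_split:
  assumes [measurable]: "f \<in> borel_measurable state_space"
  shows "(\<integral>\<^sup>+ z. f (next_state x z) \<partial>I) = Q f x + f (0, 0) * emptying x"
proof -
  have "(\<integral>\<^sup>+ z. f (next_state x z) \<partial>I) =
      (\<integral>\<^sup>+ z. (if next_state x z = (0, 0) then 0 else f (next_state x z))
        + f (0, 0) * indicator {(0, 0)} (next_state x z) \<partial>I)"
    by (intro nn_integral_cong) auto
  then show ?thesis
    unfolding Q_def emptying_def by (simp add: nn_integral_add nn_integral_cmult)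
qed

lemma emptying_add: "Q (\<lambda>_. 1) x + emptying x = 1"
  using one_step_split[of "\<lambda>_. 1" x] by (simp add: I.emeasure_space_1)

lemma nn_integral_next_state:
  assumes "sets N = sets state_space"
    and [measurable]: "f \<in> borel_measurable state_space"
  shows "(\<integral>\<^sup>+ y. f y \<partial>distr (N \<Otimes>\<^sub>M I) borel (\<lambda>(x, z). next_state x z)) =
      (\<integral>\<^sup>+ x. Q f x + f (0, 0) * emptying x \<partial>N)"
proof -
  note [measurable_cong] = assms(1)
  have "(\<integral>\<^sup>+ y. f y \<partial>distr (N \<Otimes>\<^sub>M I) borel (\<lambda>(x, z). next_state x z)) =
      (\<integral>\<^sup>+ (x, z). f (next_state x z) \<partial>(N \<Otimes>\<^sub>M I))"
    by (subst nn_integral_distr) (auto simp: split_beta')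
  also have "\<dots> = (\<integral>\<^sup>+ x. \<integral>\<^sup>+ z. f (next_state x z) \<partial>I \<partial>N)"
    by (subst I.nn_integral_fst[symmetric]) auto
  also have "\<dots> = (\<integral>\<^sup>+ x. Q f x + f (0, 0) * emptying x \<partial>N)"
    by (simp add: one_step_split)
  finally show ?thesis .
qed

text \<open>
  Decompose according to the last visit to the empty state: unrolling the invariance equation \<open>n\<close> times
  counts the visits that are at most \<open>n\<close> steps old, and what remains is the mass of excursions that have
  survived for \<open>n\<close> steps, which vanishes.
\<close>

lemma stationary_emeasure:
  assumes "stationary lam F p \<nu>"
    and B: "B \<in> sets state_space"
  shows "emeasure \<nu> B = emeasure \<nu> {(0, 0)} * occupation (indicator B)"
proof -
  have \<nu>: "prob_space \<nu>" "sets \<nu> = sets state_space"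
      "distr (\<nu> \<Otimes>\<^sub>M I) borel (\<lambda>(x, z). next_state x z) = \<nu>"
    using assms(1) by (auto simp: stationary_def)
  interpret \<nu>: prob_space \<nu> by fact
  note [measurable_cong] = \<nu>(2)
  note [measurable] = B
  have inv: "(\<integral>\<^sup>+ x. f x \<partial>\<nu>) = (\<integral>\<^sup>+ x. Q f x \<partial>\<nu>) + f (0, 0) * (\<integral>\<^sup>+ x. emptying x \<partial>\<nu>)"
    if [measurable]: "f \<in> borel_measurable state_space" for f
    using nn_integral_next_state[OF \<nu>(2) that] unfolding \<nu>(3)
    by (simp add: nn_integral_add nn_integral_cmult)
  have Q0: "Q (indicator {(0, 0)}) = (\<lambda>_. 0)"
    by (auto simp: Q_def fun_eq_iff nn_integral_0_iff_AE)
  have "emeasure \<nu> {(0, 0)} = (\<integral>\<^sup>+ x. indicator {(0, 0)} x \<partial>\<nu>)" by simp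
  also have "\<dots> = (\<integral>\<^sup>+ x. emptying x \<partial>\<nu>)"
    by (subst inv) (auto simp: Q0)
  finally have e0: "(\<integral>\<^sup>+ x. emptying x \<partial>\<nu>) = emeasure \<nu> {(0, 0)}" ..
  let ?f = "indicator B :: real \<times> real \<Rightarrow> ennreal"
  have unroll: "emeasure \<nu> B = emeasure \<nu> {(0, 0)} * (\<Sum>k<n. (Q ^^ k) ?f (0, 0)) + (\<integral>\<^sup>+ x. (Q ^^ n) ?f x \<partial>\<nu>)" for n
  proof (induction n)
    case 0
    show ?case by simp
  next
    case (Suc n)
    show ?case
      unfolding Suc by (subst inv) (auto simp: e0 algebra_simps)
  qed
  have "(\<lambda>n. \<integral>\<^sup>+ x. (Q ^^ n) ?f x \<partial>\<nu>) \<longlonglongrightarrow> (\<integral>\<^sup>+ x. 0 \<partial>\<nu>)"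
  proof (rule nn_integral_dominated_convergence[where w = "\<lambda>_. 1"])
    have le: "(Q ^^ n) ?f x \<le> (Q ^^ n) (\<lambda>_. 1) x" for n x
      by (intro Q_funpow_mono) (auto split: split_indicator)
    have le1: "(Q ^^ n) (\<lambda>_. 1) x \<le> 1" for n x
    proof (induction n arbitrary: x)
      case (Suc n)
      have "(Q ^^ Suc n) (\<lambda>_. 1) x \<le> Q (\<lambda>_. 1) x"
        using Q_mono[OF Suc] by simp
      also have "\<dots> \<le> 1" using emptying_add[of x] by (metis le_iff_add)
      finally show ?case .
    qed simp
    show "AE x in \<nu>. (Q ^^ n) ?f x \<le> 1" for n
      using order_trans[OF le le1] by (rule AE_I2)
    show "AE x in \<nu>. (\<lambda>n. (Q ^^ n) ?f x) \<longlonglongrightarrow> 0"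
    proof (rule AE_I2)
      fix x
      show "(\<lambda>n. (Q ^^ n) ?f x) \<longlonglongrightarrow> 0"
        by (rule tendsto_sandwich[OF _ _ tendsto_const Q_funpow_one_tendsto_0[of x]]) (auto simp: le)
    qed
  qed (auto simp: \<nu>.emeasure_space_1)
  then have "(\<lambda>n. emeasure \<nu> {(0, 0)} * (\<Sum>k<n. (Q ^^ k) ?f (0, 0)) + (\<integral>\<^sup>+ x. (Q ^^ n) ?f x \<partial>\<nu>))
      \<longlonglongrightarrow> emeasure \<nu> {(0, 0)} * occupation ?f + 0"
    unfolding occupation_def
    by (intro tendsto_add ennreal_tendsto_cmult summable_LIMSEQ) (auto simp: \<nu>.emeasure_finite less_top[symmetric])
  then show ?thesis
    unfolding unroll[symmetric] by (simp add: LIMSEQ_const_iff)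
qed

text \<open>
  The normalised occupation measure of a cycle, written as an image measure so that
  countable additivity is automatic. The density on pairs \<open>(k, z)\<close> selects the steps before the end of
  the cycle.
\<close>

definition cycle_stationary :: "(real \<times> real) measure" where
  "cycle_stationary =
     distr (density (count_space UNIV \<Otimes>\<^sub>M inputs) (\<lambda>(k, z). reward (\<lambda>_. inverse mean_length) k (0, 0) z))
       borel (\<lambda>(k, z). seen z k)"

lemma sets_cycle_stationary [measurable_cong, simp]: "sets cycle_stationary = sets state_space"
  by (simp add: cycle_stationary_def)

lemma measurable_seen [measurable]: "(\<lambda>z. seen z k) \<in> inputs \<rightarrow>\<^sub>M state_space"
  unfolding trajectory_empty[symmetric] by measurable

lemma nn_integral_cycle_stationary:
  assumes [measurable]: "f \<in> borel_measurable state_space"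
  shows "(\<integral>\<^sup>+ x. f x \<partial>cycle_stationary) = occupation f * inverse mean_length"
proof -
  have [measurable]: "(\<lambda>(k, z). seen z k) \<in> count_space UNIV \<Otimes>\<^sub>M inputs \<rightarrow>\<^sub>M state_space"
    by (rule measurable_pair_measure_countable1) auto
  have [measurable]: "(\<lambda>(k, z). reward (\<lambda>_. inverse mean_length) k (0, 0) z) \<in> borel_measurable (count_space UNIV \<Otimes>\<^sub>M inputs)"
    by (rule measurable_pair_measure_countable1) auto
  have "(\<integral>\<^sup>+ x. f x \<partial>cycle_stationary) =
      (\<integral>\<^sup>+ (k, z). reward (\<lambda>_. inverse mean_length) k (0, 0) z * f (seen z k) \<partial>(count_space UNIV \<Otimes>\<^sub>M inputs))"
    unfolding cycle_stationary_def
    by (subst nn_integral_distr) (auto simp: nn_integral_density split_beta')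
  also have "\<dots> = (\<integral>\<^sup>+ k. \<integral>\<^sup>+ z. reward (\<lambda>_. inverse mean_length) k (0, 0) z * f (seen z k) \<partial>inputs \<partial>count_space UNIV)"
    by (subst seq.nn_integral_fst[symmetric]) (auto intro!: borel_measurable_times_ennreal measurable_pair_measure_countable1 simp: split_beta')
  also have "\<dots> = (\<integral>\<^sup>+ k. (\<integral>\<^sup>+ z. reward f k (0, 0) z \<partial>inputs) * inverse mean_length \<partial>count_space UNIV)"
    by (intro nn_integral_cong, subst nn_integral_multc[symmetric])
      (auto simp: reward_def trajectory_empty mult.commute intro!: nn_integral_cong)
  also have "\<dots> = occupation f * inverse mean_length"
    by (simp add: nn_integral_count_space_nat nn_integral_reward occupation_def)
  finally show ?thesis .
qed

text \<open>
  A cycle ends exactly once.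
\<close>

lemma occupation_emptying: "occupation emptying = 1"
proof -
  have sum: "(\<Sum>k<n. (Q ^^ k) emptying (0, 0)) + (Q ^^ n) (\<lambda>_. 1) (0, 0) = 1" for n
  proof (induction n)
    case (Suc n)
    have "(Q ^^ n) (\<lambda>_. 1) (0, 0) = (Q ^^ n) (\<lambda>x. Q (\<lambda>_. 1) x + emptying x) (0, 0)"
      by (simp add: emptying_add)
    also have "\<dots> = (Q ^^ Suc n) (\<lambda>_. 1) (0, 0) + (Q ^^ n) emptying (0, 0)"
      by (subst Q_funpow_add) (auto simp: funpow_swap1)
    finally show ?case
      using Suc by (simp add: algebra_simps)
  qed simp
  have "(\<lambda>n. (\<Sum>k<n. (Q ^^ k) emptying (0, 0)) + (Q ^^ n) (\<lambda>_. 1) (0, 0)) \<longlonglongrightarrow> occupation emptying + 0"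
    unfolding occupation_def by (intro tendsto_add summable_LIMSEQ Q_funpow_one_tendsto_0) auto
  then show ?thesis
    unfolding sum by (simp add: LIMSEQ_const_iff)
qed

lemma occupation_unfold: "occupation f = f (0, 0) + occupation (Q f)"
  unfolding occupation_def
  by (subst suminf_offset[of _ 1]) (auto simp: funpow_swap1)

text \<open>
  One transition shifts the cycle by one step. It loses the initial visit to the empty state and
  gains the final one, and these two balance.
\<close>

lemma stationary_cycle_stationary: "stationary lam F p cycle_stationary"
  unfolding stationary_def
proof (intro conjI)
  show "prob_space cycle_stationary"
  proof
    have "emeasure cycle_stationary (space cycle_stationary) = (\<integral>\<^sup>+ x. 1 \<partial>cycle_stationary)" by simp
    also have "\<dots> = 1"
      using mean_length_finite by (subst nn_integral_cycle_stationary) (auto simp: ennreal_divide_self less_top[symmetric] divide_ennreal_def[symmetric])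
    finally show "emeasure cycle_stationary (space cycle_stationary) = 1" .
  qed
  show "distr (cycle_stationary \<Otimes>\<^sub>M I) borel (\<lambda>(x, z). next_state x z) = cycle_stationary"
  proof (rule measure_eqI)
    fix B
    assume "B \<in> sets (distr (cycle_stationary \<Otimes>\<^sub>M I) borel (\<lambda>(x, z). next_state x z))"
    then have [measurable]: "B \<in> sets state_space" by simp
    let ?f = "indicator B :: real \<times> real \<Rightarrow> ennreal"
    have "emeasure (distr (cycle_stationary \<Otimes>\<^sub>M I) borel (\<lambda>(x, z). next_state x z)) B =
        (\<integral>\<^sup>+ x. ?f x \<partial>distr (cycle_stationary \<Otimes>\<^sub>M I) borel (\<lambda>(x, z). next_state x z))"
      by simp
    also have "\<dots> = (\<integral>\<^sup>+ x. Q ?f x + ?f (0, 0) * emptying x \<partial>cycle_stationary)"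
      by (rule nn_integral_next_state) auto
    also have "\<dots> = occupation (Q ?f) * inverse mean_length + ?f (0, 0) * (occupation emptying * inverse mean_length)"
      by (simp add: nn_integral_add nn_integral_cmult nn_integral_cycle_stationary)
    also have "\<dots> = occupation ?f * inverse mean_length"
      by (simp add: occupation_emptying occupation_unfold[of ?f] algebra_simps)
    also have "\<dots> = emeasure cycle_stationary B"
      by (subst nn_integral_cycle_stationary[symmetric]) auto
    finally show "emeasure (distr (cycle_stationary \<Otimes>\<^sub>M I) borel (\<lambda>(x, z). next_state x z)) B = emeasure cycle_stationary B" .
  qed simp
qed simp

lemma stationary_law_eq: "stationary_law lam F p = cycle_stationary"
  unfolding stationary_law_def
proof (rule the_equality, rule stationary_cycle_stationary)
  fix \<nu>
  assume \<nu>: "stationary lam F p \<nu>"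
  then have "prob_space \<nu>" and s: "sets \<nu> = sets state_space"
    by (auto simp: stationary_def)
  then interpret \<nu>: prob_space \<nu> by simp
  have "space \<nu> = UNIV" using sets_eq_imp_space_eq[OF s] by simp
  then have "1 = emeasure \<nu> {(0, 0)} * mean_length"
    using stationary_emeasure[OF \<nu>, of UNIV] \<nu>.emeasure_space_1 by simp
  then have "inverse mean_length = emeasure \<nu> {(0, 0)} * (mean_length * inverse mean_length)"
    by (simp add: mult.assoc[symmetric])
  then have e: "emeasure \<nu> {(0, 0)} = inverse mean_length"
    using mean_length_finite by (simp add: divide_ennreal_def[symmetric] ennreal_divide_self less_top[symmetric])
  show "\<nu> = cycle_stationary"
  proof (rule measure_eqI)
    fix B
    assume "B \<in> sets \<nu>"
    then have [measurable]: "B \<in> sets state_space" using s by simp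
    have "emeasure \<nu> B = inverse mean_length * occupation (indicator B)"
      using stationary_emeasure[OF \<nu>, of B] by (simp add: e)
    also have "\<dots> = emeasure cycle_stationary B"
      using nn_integral_cycle_stationary[of "indicator B"] by (simp add: mult.commute)
    finally show "emeasure \<nu> B = emeasure cycle_stationary B" .
  qed (simp add: s)
qed

end

section \<open>Cycle sums and stationary expectations\<close>

context routed_queue
begin

lemma cycle_length_eq: "cycle_length z = (LEAST n. 1 \<le> n \<and> seen z n = (0, 0))"
  unfolding cycle_length_def Inf_nat_def by simp

lemma measurable_cycle_length [measurable]: "cycle_length \<in> inputs \<rightarrow>\<^sub>M count_space UNIV"
  unfolding cycle_length_eq[abs_def] by measurable

definition cycle_reward :: "(real \<times> real \<Rightarrow> real) \<Rightarrow> (nat \<Rightarrow> input) \<Rightarrow> real" where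
  "cycle_reward f z = (\<Sum>j<cycle_length z. f (seen z j))"

lemma measurable_cycle_reward [measurable]:
  assumes [measurable]: "f \<in> borel_measurable state_space"
  shows "cycle_reward f \<in> borel_measurable inputs"
  unfolding cycle_reward_def[abs_def]
  by (rule measurable_compose_countable[where g = cycle_length]) measurable

lemma reward_before_return:
  assumes ret: "1 \<le> n" "seen z n = (0, 0)"
  shows "1 \<le> cycle_length z"
    and "reward \<phi> k (0, 0) z = (if k < cycle_length z then \<phi> (seen z k) else 0)"
proof -
  have L: "1 \<le> cycle_length z \<and> seen z (cycle_length z) = (0, 0)"
    unfolding cycle_length_eq by (rule LeastI) (use ret in blast)
  then show "1 \<le> cycle_length z" by simp
  have "unreturned k (0, 0) z \<longleftrightarrow> k < cycle_length z"
  proof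
    assume "unreturned k (0, 0) z"
    with L show "k < cycle_length z"
      unfolding unreturned_def trajectory_empty by (meson atLeastAtMost_iff not_less)
  next
    assume k: "k < cycle_length z"
    show "unreturned k (0, 0) z"
      unfolding unreturned_def trajectory_empty
    proof (intro ballI notI)
      fix i
      assume "i \<in> {1..k}" "seen z i = (0, 0)"
      then have "cycle_length z \<le> i"
        unfolding cycle_length_eq by (intro Least_le) simp
      with k \<open>i \<in> {1..k}\<close> show False by simp
    qed
  qed
  then show "reward \<phi> k (0, 0) z = (if k < cycle_length z then \<phi> (seen z k) else 0)"
    by (simp add: reward_def trajectory_empty)
qed

text \<open>
  On a path that never returns, each step would contribute 1 to the cycle length, whose mean is finite.
\<close>

lemma AE_returns: "AE z in inputs. \<exists>n\<ge>1. seen z n = (0, 0)"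
proof -
  have "(\<integral>\<^sup>+ z. (\<Sum>k. reward (\<lambda>_. 1) k (0, 0) z) \<partial>inputs) = mean_length"
    by (subst nn_integral_suminf) (auto simp: nn_integral_reward occupation_def)
  then have "AE z in inputs. (\<Sum>k. reward (\<lambda>_. 1) k (0, 0) z) \<noteq> \<infinity>"
    using mean_length_finite by (intro nn_integral_PInf_AE) auto
  then show ?thesis
  proof eventually_elim
    case (elim z)
    show ?case
    proof (rule ccontr)
      assume "\<not> ?thesis"
      then have "reward (\<lambda>_. 1) k (0, 0) z = 1" for k
        by (auto simp: reward_def unreturned_def trajectory_empty)
      moreover have "\<not> (\<lambda>_. 1 :: ennreal) \<longlonglongrightarrow> 0"
        by (simp add: LIMSEQ_const_iff)
      ultimately show False
        using ennreal_suminf_tendsto_zero[of "\<lambda>k. reward (\<lambda>_. 1) k (0, 0) z"] elim by simp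
    qed
  qed
qed

lemma cycle_reward_eq_suminf:
  assumes ret: "1 \<le> n" "seen z n = (0, 0)" and f: "\<And>x. 0 \<le> f x"
  shows "ennreal (cycle_reward f z) = (\<Sum>k. reward (\<lambda>x. ennreal (f x)) k (0, 0) z)"
    and "ennreal (cycle_reward f z) = (\<Sum>k<cycle_length z. reward (\<lambda>x. ennreal (f x)) k (0, 0) z)"
proof -
  show *: "ennreal (cycle_reward f z) = (\<Sum>k<cycle_length z. reward (\<lambda>x. ennreal (f x)) k (0, 0) z)"
    by (simp add: cycle_reward_def reward_before_return(2)[OF ret] f sum_nonneg flip: sum_ennreal)
  show "ennreal (cycle_reward f z) = (\<Sum>k. reward (\<lambda>x. ennreal (f x)) k (0, 0) z)"
    unfolding * by (rule suminf_finite[symmetric]) (auto simp: reward_before_return(2)[OF ret])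
qed

lemma nn_integral_cycle_reward:
  assumes [measurable]: "f \<in> borel_measurable state_space" and f: "\<And>x. 0 \<le> f x"
  shows "(\<integral>\<^sup>+ z. ennreal (cycle_reward f z) \<partial>inputs) = mean_length * (\<integral>\<^sup>+ x. ennreal (f x) \<partial>cycle_stationary)"
proof -
  have "(\<integral>\<^sup>+ z. ennreal (cycle_reward f z) \<partial>inputs) = (\<integral>\<^sup>+ z. (\<Sum>k. reward (\<lambda>x. ennreal (f x)) k (0, 0) z) \<partial>inputs)"
    by (rule nn_integral_cong_AE, use AE_returns in eventually_elim) (use cycle_reward_eq_suminf(1) f in blast)
  also have "\<dots> = occupation (\<lambda>x. ennreal (f x))"
    by (subst nn_integral_suminf) (auto simp: nn_integral_reward occupation_def)
  also have "\<dots> = (mean_length * inverse mean_length) * occupation (\<lambda>x. ennreal (f x))"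
    using mean_length_finite by (simp add: divide_ennreal_def[symmetric] ennreal_divide_self less_top[symmetric])
  also have "\<dots> = mean_length * (\<integral>\<^sup>+ x. ennreal (f x) \<partial>cycle_stationary)"
    by (subst nn_integral_cycle_stationary) (auto simp: mult_ac)
  finally show ?thesis .
qed

abbreviation linearly_bounded :: "real \<Rightarrow> (real \<times> real \<Rightarrow> real) \<Rightarrow> bool" where
  "linearly_bounded B f \<equiv> \<forall>x. \<bar>f x\<bar> \<le> B * (load x + r)"

lemma renewal_reward_nonneg:
  assumes [measurable]: "f \<in> borel_measurable state_space" and f: "\<And>x. 0 \<le> f x"
    and B: "linearly_bounded B f"
  shows "integrable cycle_stationary f" "integrable inputs (cycle_reward f)"
    "(\<integral>z. cycle_reward f z \<partial>inputs) = enn2real mean_length * (\<integral>x. f x \<partial>cycle_stationary)"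
proof -
  have "(\<integral>\<^sup>+ x. ennreal (f x) \<partial>cycle_stationary) \<le> (\<integral>\<^sup>+ x. ennreal B * g x \<partial>cycle_stationary)"
  proof (intro nn_integral_mono)
    fix x
    have "f x \<le> B * (load x + r)" using B f[of x] by (metis abs_of_nonneg)
    then show "ennreal (f x) \<le> ennreal B * g x"
      using load_nonneg[of x] constants(1) by (subst ennreal_mult''[symmetric]) (auto intro: ennreal_leI)
  qed
  also have "\<dots> = ennreal B * (occupation g * inverse mean_length)"
    by (simp add: nn_integral_cmult nn_integral_cycle_stationary)
  also have "\<dots> < top"
  proof -
    have "occupation g < top" by (rule le_less_trans[OF occupation_g_le]) simp
    moreover have "inverse mean_length < top" using mean_length_finite by (simp add: less_top[symmetric])
    ultimately show ?thesis by (simp add: ennreal_mult_less_top)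
  qed
  finally have fin: "(\<integral>\<^sup>+ x. ennreal (f x) \<partial>cycle_stationary) < top" .
  show 1: "integrable cycle_stationary f"
    using fin f by (intro integrableI_nonneg) auto
  have pos: "0 \<le> cycle_reward f z" for z
    unfolding cycle_reward_def by (intro sum_nonneg f)
  have "mean_length < top" using mean_length_finite by (simp add: less_top[symmetric])
  then have "(\<integral>\<^sup>+ z. ennreal (cycle_reward f z) \<partial>inputs) < top"
    unfolding nn_integral_cycle_reward[OF assms(1) f] by (simp add: ennreal_mult_less_top fin)
  then show "integrable inputs (cycle_reward f)"
    using pos by (intro integrableI_nonneg) auto
  have "(\<integral>z. cycle_reward f z \<partial>inputs) = enn2real (\<integral>\<^sup>+ z. ennreal (cycle_reward f z) \<partial>inputs)"
    using pos by (intro integral_eq_nn_integral) auto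
  also have "\<dots> = enn2real mean_length * enn2real (\<integral>\<^sup>+ x. ennreal (f x) \<partial>cycle_stationary)"
    unfolding nn_integral_cycle_reward[OF assms(1) f] by (rule enn2real_mult)
  also have "enn2real (\<integral>\<^sup>+ x. ennreal (f x) \<partial>cycle_stationary) = (\<integral>x. f x \<partial>cycle_stationary)"
    using f by (intro integral_eq_nn_integral[symmetric]) auto
  finally show "(\<integral>z. cycle_reward f z \<partial>inputs) = enn2real mean_length * (\<integral>x. f x \<partial>cycle_stationary)" .
qed

text \<open>
  The mean of a cycle sum is the mean cycle length times the stationary expectation.
  The linear bound makes all terms finite, so that signed rewards can be split into
  positive and negative parts.
\<close>

lemma renewal_reward:
  assumes [measurable]: "f \<in> borel_measurable state_space"
    and B: "linearly_bounded B f"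
  shows "integrable cycle_stationary f" "integrable inputs (cycle_reward f)"
    "(\<integral>z. cycle_reward f z \<partial>inputs) = enn2real mean_length * (\<integral>x. f x \<partial>cycle_stationary)"
proof -
  let ?p = "\<lambda>x. max 0 (f x)" and ?m = "\<lambda>x. max 0 (- f x)"
  have "linearly_bounded B ?p" "linearly_bounded B ?m"
    using B by (smt (verit))+
  note P = renewal_reward_nonneg[OF _ _ this(1)] and N = renewal_reward_nonneg[OF _ _ this(2)]
  have f: "f = (\<lambda>x. ?p x - ?m x)" by auto
  have r: "cycle_reward f = (\<lambda>z. cycle_reward ?p z - cycle_reward ?m z)"
    by (subst f) (simp add: cycle_reward_def sum_subtractf fun_eq_iff)
  show "integrable cycle_stationary f"
    by (subst f) (intro Bochner_Integration.integrable_diff P N; simp)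
  show "integrable inputs (cycle_reward f)"
    unfolding r by (intro Bochner_Integration.integrable_diff P N; simp)
  have "(\<integral>z. cycle_reward f z \<partial>inputs) = enn2real mean_length * ((\<integral>x. ?p x \<partial>cycle_stationary) - (\<integral>x. ?m x \<partial>cycle_stationary))"
    unfolding r by (subst Bochner_Integration.integral_diff) (auto simp: P N right_diff_distrib)
  also have "(\<integral>x. ?p x \<partial>cycle_stationary) - (\<integral>x. ?m x \<partial>cycle_stationary) = (\<integral>x. ?p x - ?m x \<partial>cycle_stationary)"
    by (rule Bochner_Integration.integral_diff[symmetric]) (auto intro: P N)
  finally show "(\<integral>z. cycle_reward f z \<partial>inputs) = enn2real mean_length * (\<integral>x. f x \<partial>cycle_stationary)"
    using f by simp
qed

lemma cycle_reward_second_moment: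
  assumes B: "linearly_bounded B f"
  shows "(\<integral>\<^sup>+ z. ennreal ((cycle_reward f z)\<^sup>2) \<partial>inputs) \<le> ennreal (B\<^sup>2 * (A * r ^ 4))"
proof -
  let ?S = "\<lambda>n z. \<Sum>k<n. reward g k (0, 0) z"
  have g0: "0 \<le> load x + r" for x using load_nonneg[of x] constants by simp
  have "(\<integral>\<^sup>+ z. ennreal ((cycle_reward f z)\<^sup>2) \<partial>inputs) \<le> (\<integral>\<^sup>+ z. ennreal (B\<^sup>2) * (SUP n. (?S n z)\<^sup>2) \<partial>inputs)"
  proof (rule nn_integral_mono_AE, use AE_returns in eventually_elim)
    case (elim z)
    then obtain n where n: "1 \<le> n" "seen z n = (0, 0)" by blast
    let ?R = "cycle_reward (\<lambda>x. load x + r) z"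
    have R0: "0 \<le> ?R" unfolding cycle_reward_def by (intro sum_nonneg g0)
    have "\<bar>cycle_reward f z\<bar> \<le> (\<Sum>j<cycle_length z. \<bar>f (seen z j)\<bar>)"
      unfolding cycle_reward_def by (rule sum_abs)
    also have "\<dots> \<le> B * ?R"
      unfolding cycle_reward_def sum_distrib_left by (intro sum_mono B[rule_format])
    finally have "(cycle_reward f z)\<^sup>2 \<le> (B * ?R)\<^sup>2"
      by (rule abs_le_square_iff[THEN iffD1, OF order_trans]) simp
    then have "ennreal ((cycle_reward f z)\<^sup>2) \<le> ennreal (B\<^sup>2) * (ennreal ?R)\<^sup>2"
      using R0 by (simp add: power_mult_distrib ennreal_power ennreal_leI flip: ennreal_mult)
    also have "(ennreal ?R)\<^sup>2 = (?S (cycle_length z) z)\<^sup>2"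
      by (simp only: cycle_reward_eq_suminf(2)[OF n, of "\<lambda>x. load x + r", OF g0])
    also have "ennreal (B\<^sup>2) * (?S (cycle_length z) z)\<^sup>2 \<le> ennreal (B\<^sup>2) * (SUP n. (?S n z)\<^sup>2)"
      by (intro mult_left_mono SUP_upper) auto
    finally show ?case .
  qed
  also have "\<dots> = ennreal (B\<^sup>2) * (\<integral>\<^sup>+ z. (SUP n. (?S n z)\<^sup>2) \<partial>inputs)"
    by (rule nn_integral_cmult) measurable
  also have "(\<integral>\<^sup>+ z. (SUP n. (?S n z)\<^sup>2) \<partial>inputs) = (SUP n. \<integral>\<^sup>+ z. (?S n z)\<^sup>2 \<partial>inputs)"
    by (intro nn_integral_monotone_convergence_SUP)
      (auto simp: incseq_def le_fun_def intro!: power_mono sum_mono2)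
  also have "\<dots> \<le> V4 (0, 0)"
    by (intro SUP_least reward_second_moment)
  finally show ?thesis
    using constants by (simp add: load_def ennreal_mult mult_left_mono)
qed

lemma enn2real_mean_length_bounds: "1 \<le> enn2real mean_length" "enn2real mean_length \<le> a * r\<^sup>2"
proof -
  have "ennreal 1 \<le> ennreal (enn2real mean_length)" using mean_length_bounds mean_length_finite by (simp add: less_top)
  then show "1 \<le> enn2real mean_length" by (subst (asm) ennreal_le_iff) auto
  have "mean_length \<le> ennreal (a * r\<^sup>2)" using mean_length_bounds(2) by (simp add: load_def)
  then show "enn2real mean_length \<le> a * r\<^sup>2"
    using constants by (intro enn2real_leI) auto
qed

text \<open>
  The inner product with \<open>(1, - 1)\<close> is the advantage of sensing. Only this component of the cycle sum
  moves the projected iterates.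
\<close>

lemma cycle_law_moments:
  fixes cs cw
  defines "B \<equiv> \<bar>cs\<bar> + 2 * \<bar>cw\<bar>"
  shows "prob_space (cycle_law lam F cs cw p)" "sets (cycle_law lam F cs cw p) = sets borel"
    and "integrable (cycle_law lam F cs cw p) (\<lambda>v. v \<bullet> (1, - 1))"
    and "(\<integral>v. v \<bullet> (1, - 1) \<partial>cycle_law lam F cs cw p) = enn2real mean_length * (utility lam F cs cw p \<bullet> (1, - 1))"
    and "(\<integral>\<^sup>+ v. ennreal ((v \<bullet> (1, - 1))\<^sup>2) \<partial>cycle_law lam F cs cw p) \<le> ennreal (B\<^sup>2 * (A * r ^ 4))"
proof -
  let ?d = "\<lambda>x. vbar cs cw x \<bullet> (1, - 1)"
  have v[measurable]: "vbar cs cw \<in> borel_measurable state_space"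
    unfolding vbar_def[abs_def] by measurable
  have coordinate: "\<bar>fst (vbar cs cw x)\<bar> \<le> (\<bar>cs\<bar> + \<bar>cw\<bar>) * (load x + r)"
      "\<bar>snd (vbar cs cw x)\<bar> \<le> \<bar>cw\<bar> * (load x + r)" for x
  proof -
    have l: "\<bar>snd x\<bar> \<le> load x" by (simp add: load_def)
    have "\<bar>cw\<bar> * \<bar>snd x\<bar> \<le> \<bar>cw\<bar> * (load x + r)"
      using l constants(1) by (intro mult_left_mono) auto
    moreover have "\<bar>cs\<bar> * 1 \<le> \<bar>cs\<bar> * (load x + r)"
      using load_nonneg[of x] constants(1) by (intro mult_left_mono) auto
    moreover have "0 \<le> \<bar>cw\<bar> * (load x + r)"
      using load_nonneg[of x] constants(1) by simp
    ultimately show "\<bar>snd (vbar cs cw x)\<bar> \<le> \<bar>cw\<bar> * (load x + r)"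
        "\<bar>fst (vbar cs cw x)\<bar> \<le> (\<bar>cs\<bar> + \<bar>cw\<bar>) * (load x + r)"
      using abs_triangle_ineq4[of "- cs" "cw * snd x"] mult_nonneg_nonneg[of "\<bar>cw\<bar>" "\<bar>snd x\<bar>"]
      by (auto simp: vbar_def abs_mult distrib_right of_bool_def)
  qed
  have d: "linearly_bounded B ?d"
  proof
    fix x
    show "\<bar>?d x\<bar> \<le> B * (load x + r)"
    proof -
      have "?d x = fst (vbar cs cw x) - snd (vbar cs cw x)"
        by (simp add: inner_prod_def)
      moreover have "B * (load x + r) = (\<bar>cs\<bar> + \<bar>cw\<bar>) * (load x + r) + \<bar>cw\<bar> * (load x + r)"
        by (simp add: B_def algebra_simps)
      ultimately show ?thesis
        using coordinate[of x] by linarith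
    qed
  qed
  have "integrable cycle_stationary (\<lambda>x. fst (vbar cs cw x))"
    by (rule renewal_reward(1)[OF _ allI[OF coordinate(1)]]) (unfold vbar_def fst_conv, measurable)
  moreover have "integrable cycle_stationary (\<lambda>x. snd (vbar cs cw x))"
    by (rule renewal_reward(1)[OF _ allI[OF coordinate(2)]]) (unfold vbar_def snd_conv, measurable)
  ultimately have "integrable cycle_stationary (\<lambda>x. fst (vbar cs cw x) *\<^sub>R (1 :: real, 0) + snd (vbar cs cw x) *\<^sub>R (0, 1 :: real))"
    by (intro Bochner_Integration.integrable_add integrable_scaleR_left) auto
  then have iv: "integrable cycle_stationary (vbar cs cw)"
    by (simp add: real_scaleR_def)
  have u: "utility lam F cs cw p \<bullet> (1, - 1) = (\<integral>x. ?d x \<partial>cycle_stationary)"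
    unfolding utility_def stationary_law_eq using iv by simp
  have m[measurable]: "cycle_sum cs cw \<in> borel_measurable inputs"
    unfolding cycle_sum_def[abs_def]
    by (rule measurable_compose_countable[where g = cycle_length]) measurable
  have eq: "cycle_sum cs cw z \<bullet> (1, - 1) = cycle_reward ?d z" for z
    by (simp add: cycle_sum_def cycle_reward_def inner_sum_left)
  show "prob_space (cycle_law lam F cs cw p)"
    unfolding cycle_law_def by (rule seq.prob_space_distr) measurable
  show "sets (cycle_law lam F cs cw p) = sets borel"
    by (simp add: cycle_law_def)
  show "integrable (cycle_law lam F cs cw p) (\<lambda>v. v \<bullet> (1, - 1))"
    unfolding cycle_law_def by (subst integrable_distr_eq) (auto simp: eq intro: renewal_reward(2)[OF _ d])
  show "(\<integral>v. v \<bullet> (1, - 1) \<partial>cycle_law lam F cs cw p) = enn2real mean_length * (utility lam F cs cw p \<bullet> (1, - 1))"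
    unfolding cycle_law_def u by (subst integral_distr) (auto simp: eq intro: renewal_reward(3)[OF _ d])
  show "(\<integral>\<^sup>+ v. ennreal ((v \<bullet> (1, - 1))\<^sup>2) \<partial>cycle_law lam F cs cw p) \<le> ennreal (B\<^sup>2 * (A * r ^ 4))"
    unfolding cycle_law_def by (subst nn_integral_distr) (auto simp: eq intro: cycle_reward_second_moment[OF d])
qed

end

lemma (in stable_queue) uniform_cycle_moments:
  obtains C where "0 \<le> C"
    "\<And>p. prob_space (cycle_law lam F cs cw p)" "\<And>p. sets (cycle_law lam F cs cw p) = sets borel"
    "\<And>p. integrable (cycle_law lam F cs cw p) (\<lambda>v. v \<bullet> (1, - 1))"
    "\<And>p. \<exists>l. 1 \<le> l \<and> l \<le> C \<and>
        (\<integral>v. v \<bullet> (1, - 1) \<partial>cycle_law lam F cs cw p) = l * (utility lam F cs cw p \<bullet> (1, - 1))"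
    "\<And>p. (\<integral>\<^sup>+ v. ennreal ((v \<bullet> (1, - 1))\<^sup>2) \<partial>cycle_law lam F cs cw p) \<le> ennreal C"
proof -
  obtain r a A where *: "1 \<le> r" "0 < a" "0 < A"
    "\<And>u. r \<le> u \<Longrightarrow> a * (\<integral>z. (u + net z) ^ 2 \<partial>(F \<Otimes>\<^sub>M Exp)) + u \<le> a * u ^ 2"
    "\<And>u. r \<le> u \<Longrightarrow> A * (\<integral>z. (u + net z) ^ 4 \<partial>(F \<Otimes>\<^sub>M Exp)) + 2 * u * (a * u ^ 2) + u ^ 2 \<le> A * u ^ 4"
    by (rule lyapunov_constants) blast
  have R: "routed_queue lam mu F r a A"
    by unfold_locales (use * in auto)
  define C where "C = max (a * r\<^sup>2) ((\<bar>cs\<bar> + 2 * \<bar>cw\<bar>)\<^sup>2 * (A * r ^ 4))"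
  note moments = routed_queue.cycle_law_moments[OF R]
  show thesis
  proof (rule that[of C])
    fix p
    show "\<exists>l. 1 \<le> l \<and> l \<le> C \<and>
        (\<integral>v. v \<bullet> (1, - 1) \<partial>cycle_law lam F cs cw p) = l * (utility lam F cs cw p \<bullet> (1, - 1))"
      using moments(4) routed_queue.enn2real_mean_length_bounds[OF R] unfolding C_def
      by (meson max.coboundedI1)
    show "(\<integral>\<^sup>+ v. ennreal ((v \<bullet> (1, - 1))\<^sup>2) \<partial>cycle_law lam F cs cw p) \<le> ennreal C"
      using moments(5)[of cs cw p] by (rule order_trans) (auto intro: ennreal_leI simp: C_def)
    show "0 \<le> C" using * by (simp add: C_def le_max_iff_disj)
  qed (rule moments)+
qed

section \<open>The simplex of strategies and the learning algorithm\<close>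

lemma strategies_eq_image: "strategies = (\<lambda>x. (x, 1 - x)) ` {0..1}"
  by (auto simp: strategies_def)

text \<open>
  Along the segment, the squared distance to \<open>v\<close> is a constant plus twice the squared distance of the
  parameter to \<open>m\<close>; hence the projection truncates \<open>m\<close> to \<open>[0, 1]\<close>.
\<close>

lemma closest_point_strategies:
  fixes v :: "real \<times> real"
  shows "closest_point strategies v =
    (let x = max 0 (min 1 ((fst v - snd v + 1) / 2)) in (x, 1 - x))"
proof -
  obtain a b where v: "v = (a, b)" by (cases v)
  define m where "m = (a - b + 1) / 2"
  define x where "x = max 0 (min 1 m)"
  have "closed strategies" "convex strategies"
  proof -
    have "compact strategies"
      unfolding strategies_eq_image by (intro compact_continuous_image continuous_intros) auto
    then show "closed strategies" by (rule compact_imp_closed)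
    have "strategies = closed_segment (0, 1) (1, 0)"
      unfolding strategies_eq_image closed_segment_def by (auto simp: image_iff)
    then show "convex strategies" using convex_closed_segment by metis
  qed
  moreover have "(x, 1 - x) \<in> strategies"
    by (auto simp: strategies_def x_def)
  moreover have "dist v (x, 1 - x) \<le> dist v z" if z: "z \<in> strategies" for z
  proof -
    obtain y where y: "z = (y, 1 - y)" "0 \<le> y" "y \<le> 1"
      using z by (auto simp: strategies_def)
    have square: "(a - t)\<^sup>2 + (b - (1 - t))\<^sup>2 = 2 * (t - m)\<^sup>2 + (a + b - 1)\<^sup>2 / 2" for t
    proof -
      have a: "a = 2 * m + b - 1" by (simp add: m_def field_simps)
      show ?thesis unfolding a by (simp add: power2_eq_square field_simps)
    qed
    have "\<bar>x - m\<bar> \<le> \<bar>y - m\<bar>"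
    proof -
      consider "m < 0" "x = 0" | "0 \<le> m" "m \<le> 1" "x = m" | "1 < m" "x = 1"
        unfolding x_def by linarith
      then show ?thesis using y by cases linarith+
    qed
    then have "(x - m)\<^sup>2 \<le> (y - m)\<^sup>2"
      by (simp add: abs_le_square_iff)
    then have "(a - x)\<^sup>2 + (b - (1 - x))\<^sup>2 \<le> (a - y)\<^sup>2 + (b - (1 - y))\<^sup>2"
      unfolding square by simp
    then show ?thesis
      unfolding v y(1) dist_Pair_Pair dist_real_def power2_abs by (rule real_sqrt_le_mono)
  qed
  ultimately have "(x, 1 - x) = closest_point strategies v"
    by (intro closest_point_unique) auto
  then show ?thesis
    by (simp add: x_def m_def v Let_def)
qed

text \<open>
  The payoff of \<open>(y, 1 - y)\<close> is affine in \<open>y\<close> with slope \<open>d\<close>.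
\<close>

lemma equilibrium_iff:
  fixes lam cs cw x :: real and F :: "real measure"
  assumes "x \<in> {0..1}"
  defines "d \<equiv> utility lam F cs cw (x, 1 - x) \<bullet> (1, - 1)"
  shows "equilibrium lam F cs cw (x, 1 - x) \<longleftrightarrow> (x < 1 \<longrightarrow> d \<le> 0) \<and> (0 < x \<longrightarrow> 0 \<le> d)"
proof -
  obtain u v where u: "utility lam F cs cw (x, 1 - x) = (u, v)" by (cases "utility lam F cs cw (x, 1 - x)")
  have d: "d = u - v" by (simp add: d_def u)
  have gain: "(u, v) \<bullet> (y, 1 - y) = v + d * y" for y
    by (simp add: d algebra_simps)
  have "equilibrium lam F cs cw (x, 1 - x) \<longleftrightarrow> (\<forall>y\<in>{0..1}. d * y \<le> d * x)"
    using assms(1) unfolding equilibrium_def is_arg_max_def u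
    by (auto simp: strategies_eq_image gain not_less simp del: inner_Pair)
  also have "\<dots> \<longleftrightarrow> (x < 1 \<longrightarrow> d \<le> 0) \<and> (0 < x \<longrightarrow> 0 \<le> d)"
  proof
    assume le: "\<forall>y\<in>{0..1}. d * y \<le> d * x"
    have "d \<le> d * x" "0 \<le> d * x" using le[rule_format, of 1] le[rule_format, of 0] by simp_all
    then show "(x < 1 \<longrightarrow> d \<le> 0) \<and> (0 < x \<longrightarrow> 0 \<le> d)"
      by (auto simp: zero_le_mult_iff mult_le_cancel_left1)
  next
    assume *: "(x < 1 \<longrightarrow> d \<le> 0) \<and> (0 < x \<longrightarrow> 0 \<le> d)"
    show "\<forall>y\<in>{0..1}. d * y \<le> d * x"
    proof
      fix y :: real
      assume y: "y \<in> {0..1}"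
      consider "d = 0" | "d < 0" "x = 0" | "0 < d" "x = 1"
        using * assms(1) by fastforce
      then show "d * y \<le> d * x"
        by cases (use y in \<open>auto simp: mult_le_0_iff\<close>)
    qed
  qed
  finally show ?thesis .
qed

lemma infdist_strategies_le:
  fixes E :: "real set"
  assumes "E \<noteq> {}"
  shows "infdist (x, 1 - x) ((\<lambda>y. (y, 1 - y)) ` E) \<le> 2 * infdist x E"
proof -
  have "infdist (x, 1 - x) ((\<lambda>y. (y, 1 - y)) ` E) / 2 \<le> dist x y" if "y \<in> E" for y
  proof -
    have "infdist (x, 1 - x) ((\<lambda>y. (y, 1 - y)) ` E) \<le> dist (x, 1 - x) (y, 1 - y)"
      using that by (intro infdist_le) auto
    also have "\<dots> \<le> dist x y + dist (1 - x) (1 - y)"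
      unfolding dist_Pair_Pair by (rule sqrt_sum_squares_le_sum) auto
    also have "\<dots> = 2 * dist x y" by (simp add: dist_real_def abs_minus_commute)
    finally show ?thesis by simp
  qed
  then have "infdist (x, 1 - x) ((\<lambda>y. (y, 1 - y)) ` E) / 2 \<le> infdist x E"
    unfolding infdist_notempty[OF assms, of x] using assms by (intro cINF_greatest)
  then show ?thesis by simp
qed

lemma subalgebra_past:
  assumes "\<And>k. k \<in> {1..n} \<Longrightarrow> P k \<in> borel_measurable M"
    and "\<And>k. k \<in> {1..<n} \<Longrightarrow> G k \<in> borel_measurable M"
  shows "subalgebra M (past M P G n)"
  unfolding subalgebra_def past_def
proof (intro conjI)
  let ?\<A> = "{P k -` B \<inter> space M | k B. k \<in> {1..n} \<and> B \<in> sets borel} \<union>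
      {G k -` B \<inter> space M | k B. k \<in> {1..<n} \<and> B \<in> sets borel}"
  have "?\<A> \<subseteq> sets M"
    using assms by (auto intro!: measurable_sets)
  then show "sets (sigma (space M) ?\<A>) \<subseteq> sets M"
    using sets.sigma_sets_subset[of ?\<A> M] sets.space_closed[of M] by (subst sets_measure_of) auto
qed (simp add: space_measure_of_conv)

lemma space_past: "space (past M P G n) = space M"
  by (simp add: past_def space_measure_of_conv)

lemma sets_past:
  "sets (past M P G n) = sigma_sets (space M)
     ({P k -` B \<inter> space M | k B. k \<in> {1..n} \<and> B \<in> sets borel} \<union>
      {G k -` B \<inter> space M | k B. k \<in> {1..<n} \<and> B \<in> sets borel})"
  unfolding past_def by (rule sets_measure_of) auto

lemma subalgebra_past_Suc: "subalgebra (past M P G (Suc n)) (past M P G n)"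
  unfolding subalgebra_def sets_past space_past
proof (intro conjI refl sigma_sets_mono' Un_mono)
  show "{P k -` B \<inter> space M | k B. k \<in> {1..n} \<and> B \<in> sets borel}
      \<subseteq> {P k -` B \<inter> space M | k B. k \<in> {1..Suc n} \<and> B \<in> sets borel}"
    by (rule Collect_mono) (intro impI, elim exE conjE, intro exI conjI, assumption, simp_all)
  show "{G k -` B \<inter> space M | k B. k \<in> {1..<n} \<and> B \<in> sets borel}
      \<subseteq> {G k -` B \<inter> space M | k B. k \<in> {1..<Suc n} \<and> B \<in> sets borel}"
    by (rule Collect_mono) (intro impI, elim exE conjE, intro exI conjI, assumption, simp_all)
qed

lemma measurable_past:
  assumes "1 \<le> k" "k < n"
  shows "G k \<in> borel_measurable (past M P G n)"
proof (rule measurableI)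
  fix B :: "(real \<times> real) set"
  assume "B \<in> sets borel"
  then show "G k -` B \<inter> space (past M P G n) \<in> sets (past M P G n)"
    unfolding sets_past space_past using assms by (intro sigma_sets.Basic) auto
qed simp

theorem proposition9:
  fixes lam mu cs cw :: real
    and F :: "real measure"
    and \<gamma> :: "nat \<Rightarrow> real"
    and p1 :: "real \<times> real"
    and M :: "'w measure"
    and P G :: "nat \<Rightarrow> 'w \<Rightarrow> real \<times> real"
  assumes "0 < lam"
    and "prob_space F" and "sets F = sets borel" and "AE y in F. 0 \<le> y"
    and "integrable F (\<lambda>y. y)" and "(\<integral>y. y \<partial>F) = 1 / mu"
    and "lam < mu"
    and "integrable F (\<lambda>y. y ^ 4)"
    and "continuous_on strategies (utility lam F cs cw)"
    and "p1 \<in> strategies"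
    and "\<And>n. n \<ge> 1 \<Longrightarrow> 0 < \<gamma> n"
    and "filterlim (\<lambda>N. \<Sum>n=1..N. \<gamma> n) at_top at_top"
    and "summable (\<lambda>n. (\<gamma> (Suc n))\<^sup>2)"
    and "prob_space M"
    and "\<And>n. n \<ge> 1 \<Longrightarrow> G n \<in> borel_measurable M"
    and "\<And>\<omega>. \<omega> \<in> space M \<Longrightarrow> P 1 \<omega> = p1"
    and "\<And>n \<omega>. n \<ge> 1 \<Longrightarrow> \<omega> \<in> space M \<Longrightarrow>
           P (Suc n) \<omega> = closest_point strategies (P n \<omega> + \<gamma> n *\<^sub>R G n \<omega>)"
    and "\<And>n B. n \<ge> 1 \<Longrightarrow> B \<in> sets borel \<Longrightarrow>
           AE \<omega> in M. real_cond_exp M (past M P G n) (\<lambda>\<omega>. indicator B (G n \<omega>)) \<omega>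
                      = measure (cycle_law lam F cs cw (P n \<omega>)) B"
  shows "\<exists>S. S \<noteq> {} \<and> S \<subseteq> strategies \<and> (\<forall>x\<in>S. equilibrium lam F cs cw x) \<and>
           (AE \<omega> in M. (\<lambda>n. infdist (P n \<omega>) S) \<longlonglongrightarrow> 0)"
proof -
  interpret stable_queue lam mu F by (rule stable_queue.intro) fact+
  interpret M: prob_space M by fact
  note start = assms(16) and step = assms(17) and law = assms(18)
  obtain C where C: "0 \<le> C"
    "\<And>p. prob_space (cycle_law lam F cs cw p)" "\<And>p. sets (cycle_law lam F cs cw p) = sets borel"
    "\<And>p. integrable (cycle_law lam F cs cw p) (\<lambda>v. v \<bullet> (1, - 1))"
    "\<And>p. \<exists>l. 1 \<le> l \<and> l \<le> C \<and>
        (\<integral>v. v \<bullet> (1, - 1) \<partial>cycle_law lam F cs cw p) = l * (utility lam F cs cw p \<bullet> (1, - 1))"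
    "\<And>p. (\<integral>\<^sup>+ v. ennreal ((v \<bullet> (1, - 1))\<^sup>2) \<partial>cycle_law lam F cs cw p) \<le> ennreal C"
    using uniform_cycle_moments[of cs cw] by blast
\<comment> \<open>The coordinate of the iterates, indexed from 0.\<close>
  define q where "q n \<omega> = fst (P (Suc n) \<omega>)" for n \<omega>
  define g where "g n = \<gamma> (Suc n)" for n
  define D where "D n \<omega> = G (Suc n) \<omega> \<bullet> (1, - 1)" for n \<omega>
  define H where "H n = past M P G (Suc n)" for n
  define h where "h n = real_cond_exp M (H n) (D n)" for n
  define e where "e n \<omega> = (D n \<omega> - h n \<omega>) / 2" for n \<omega>
  define d where "d x = utility lam F cs cw (x, 1 - x) \<bullet> (1, - 1) / 2" for x

  have P_eq: "P (Suc n) \<omega> = (q n \<omega>, 1 - q n \<omega>)" if "\<omega> \<in> space M" for n \<omega>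
  proof (cases n)
    case 0
    then show ?thesis
      using start[OF that] \<open>p1 \<in> strategies\<close> by (auto simp: q_def strategies_def)
  next
    case (Suc k)
    then show ?thesis
      using step[of "Suc k" \<omega>] that by (simp add: q_def closest_point_strategies Let_def)
  qed
  have q_step: "q (Suc n) \<omega> = max 0 (min 1 (q n \<omega> + g n * (h n \<omega> / 2) + g n * e n \<omega>))"
    if "\<omega> \<in> space M" for n \<omega>
  proof -
    have "q (Suc n) \<omega> = fst (closest_point strategies (P (Suc n) \<omega> + g n *\<^sub>R G (Suc n) \<omega>))"
      unfolding q_def[of "Suc n"] g_def using step[of "Suc n" \<omega>] that by simp
    also have "\<dots> = max 0 (min 1 (q n \<omega> + g n * (D n \<omega> / 2)))"
      unfolding P_eq[OF that] closest_point_strategies Let_def fst_conv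
      by (rule arg_cong[where f = "\<lambda>t. max 0 (min 1 t)"])
        (simp add: D_def inner_prod_def field_simps)
    also have "q n \<omega> + g n * (D n \<omega> / 2) = q n \<omega> + g n * (h n \<omega> / 2) + g n * e n \<omega>"
      by (simp add: e_def field_simps)
    finally show ?thesis .
  qed
  have G_meas [measurable]: "G (Suc n) \<in> borel_measurable M" for n
    using assms(15)[of "Suc n"] by simp
  have P_meas: "P (Suc n) \<in> borel_measurable M" for n
  proof (induction n)
    case 0
    have "P 1 \<in> borel_measurable M \<longleftrightarrow> (\<lambda>_. p1) \<in> borel_measurable M"
      by (rule measurable_cong) (rule start)
    then show ?case by simp
  next
    case (Suc n)
    note [measurable] = Suc
    have "continuous_on UNIV (closest_point strategies)"
      unfolding closest_point_strategies[abs_def] Let_def by (intro continuous_intros) auto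
    from borel_measurable_continuous_onI[OF this]
    have [measurable]: "closest_point strategies \<in> borel_measurable borel" .
    have "P (Suc (Suc n)) \<in> borel_measurable M \<longleftrightarrow>
        (\<lambda>\<omega>. closest_point strategies (P (Suc n) \<omega> + \<gamma> (Suc n) *\<^sub>R G (Suc n) \<omega>)) \<in> borel_measurable M"
      by (rule measurable_cong) (rule step, auto)
    then show ?case by simp
  qed
  have sub: "subalgebra M (H n)" for n
    unfolding H_def
  proof (rule subalgebra_past)
    show "P k \<in> borel_measurable M" if "k \<in> {1..Suc n}" for k
      using P_meas[of "k - 1"] that by simp
    show "G k \<in> borel_measurable M" if "k \<in> {1..<Suc n}" for k
      using assms(15)[of k] that by simp
  qed
  have sub_Suc: "subalgebra (H (Suc n)) (H n)" for n
    unfolding H_def by (rule subalgebra_past_Suc)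
  have D_meas [measurable]: "D n \<in> borel_measurable M" for n
    unfolding D_def[abs_def] by measurable
  have h_meas: "h n \<in> borel_measurable (H n)" for n
    unfolding h_def by simp
  have h_meas' [measurable]: "h n \<in> borel_measurable M" for n
    unfolding h_def by simp
  have D_H: "D n \<in> borel_measurable (H (Suc n))" for n
  proof -
    have [measurable]: "G (Suc n) \<in> borel_measurable (H (Suc n))"
      unfolding H_def by (rule measurable_past) auto
    show ?thesis unfolding D_def[abs_def] by measurable
  qed
  have f_meas: "(\<lambda>v :: real \<times> real. v \<bullet> (1, - 1)) \<in> borel_measurable borel"
    by measurable
  have D2: "integrable M (\<lambda>\<omega>. (D n \<omega>)\<^sup>2)" "(\<integral>\<omega>. (D n \<omega>)\<^sup>2 \<partial>M) \<le> C"
    and h_eq: "AE \<omega> in M. h n \<omega> = (\<integral>v. v \<bullet> (1, - 1) \<partial>cycle_law lam F cs cw (P (Suc n) \<omega>))" for n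
  proof -
    let ?K = "\<lambda>\<omega>. cycle_law lam F cs cw (P (Suc n) \<omega>)"
    have law': "AE \<omega> in M. real_cond_exp M (H n) (\<lambda>\<omega>. indicator B (G (Suc n) \<omega>)) \<omega> = measure (?K \<omega>) B"
      if "B \<in> sets borel" for B
      unfolding H_def by (rule law) (use that in simp_all)
    note kernel = cond_exp_kernel_square_integrable[where \<kappa> = ?K and f = "\<lambda>v. v \<bullet> (1, - 1)",
        OF \<open>prob_space M\<close> sub G_meas C(2,3) _ f_meas C(4,6,1)]
    show "integrable M (\<lambda>\<omega>. (D n \<omega>)\<^sup>2)" "(\<integral>\<omega>. (D n \<omega>)\<^sup>2 \<partial>M) \<le> C"
        "AE \<omega> in M. h n \<omega> = (\<integral>v. v \<bullet> (1, - 1) \<partial>?K \<omega>)"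
      unfolding h_def D_def[abs_def]
      by (rule kernel(1), erule law', rule kernel(2), erule law', rule kernel(3), erule law')
  qed
  have D_int: "integrable M (D n)" for n
    by (rule M.square_integrable_imp_integrable[OF D_meas D2(1)])

  \<comment> \<open>\<open>\<bar>t\<bar> \<le> (1 + t\<^sup>2) / 2\<close> bounds the conditional mean by the second moment.\<close>
  have h_bound: "AE \<omega> in M. \<bar>h n \<omega>\<bar> \<le> (1 + C) / 2" for n
    using h_eq[of n]
  proof eventually_elim
    case (elim \<omega>)
    let ?K = "cycle_law lam F cs cw (P (Suc n) \<omega>)"
    interpret K: prob_space ?K by (rule C(2))
    have [measurable_cong]: "sets ?K = sets borel" by (rule C(3))
    have f2: "integrable ?K (\<lambda>v. (v \<bullet> (1, - 1))\<^sup>2)"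
      using C(6)[of "P (Suc n) \<omega>"] by (intro integrableI_nonneg) (auto intro: le_less_trans)
    have m2: "(\<integral>v. (v \<bullet> (1, - 1))\<^sup>2 \<partial>?K) \<le> C"
      using C(6)[of "P (Suc n) \<omega>"] C(1) by (subst (asm) nn_integral_eq_integral[OF f2]) auto
    have "\<bar>\<integral>v. v \<bullet> (1, - 1) \<partial>?K\<bar> \<le> (\<integral>v. \<bar>v \<bullet> (1, - 1)\<bar> \<partial>?K)"
      by (rule integral_abs_bound)
    also have "\<dots> \<le> (\<integral>v. (1 + (v \<bullet> (1, - 1))\<^sup>2) / 2 \<partial>?K)"
    proof (rule integral_mono)
      fix v :: "real \<times> real"
      have "0 \<le> (\<bar>v \<bullet> (1, - 1)\<bar> - 1)\<^sup>2" by simp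
      then show "\<bar>v \<bullet> (1, - 1)\<bar> \<le> (1 + (v \<bullet> (1, - 1))\<^sup>2) / 2"
        unfolding power2_diff by simp
    qed (use C(4) f2 in auto)
    also have "\<dots> = (1 + (\<integral>v. (v \<bullet> (1, - 1))\<^sup>2 \<partial>?K)) / 2"
      using f2 by (simp add: K.prob_space)
    also have "\<dots> \<le> (1 + C) / 2"
      using m2 by simp
    finally show ?case unfolding elim .
  qed
\<comment> \<open>A bound for the noise variance, from \<open>(a - b)\<^sup>2 \<le> 2 * a\<^sup>2 + 2 * b\<^sup>2\<close>.\<close>
  define c where "c = (C + ((1 + C) / 2)\<^sup>2) / 2"
  have e2: "integrable M (\<lambda>\<omega>. (e n \<omega>)\<^sup>2)" "(\<integral>\<omega>. (e n \<omega>)\<^sup>2 \<partial>M) \<le> c" for n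
  proof -
    have i: "integrable M (\<lambda>\<omega>. ((D n \<omega>)\<^sup>2 + ((1 + C) / 2)\<^sup>2) / 2)"
      using D2(1) by simp
    have le: "AE \<omega> in M. (e n \<omega>)\<^sup>2 \<le> ((D n \<omega>)\<^sup>2 + ((1 + C) / 2)\<^sup>2) / 2"
      using h_bound[of n]
    proof eventually_elim
      case (elim \<omega>)
      have "(h n \<omega>)\<^sup>2 \<le> ((1 + C) / 2)\<^sup>2"
        using elim C(1) by (intro abs_le_square_iff[THEN iffD1]) simp
      moreover have "4 * (e n \<omega>)\<^sup>2 \<le> 2 * (D n \<omega>)\<^sup>2 + 2 * (h n \<omega>)\<^sup>2"
        using zero_le_power2[of "D n \<omega> + h n \<omega>"] by (simp add: e_def power_divide power2_sum power2_diff)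
      ultimately show ?case by argo
    qed
    show *: "integrable M (\<lambda>\<omega>. (e n \<omega>)\<^sup>2)"
    proof (rule Bochner_Integration.integrable_bound[OF i])
      show "AE \<omega> in M. norm ((e n \<omega>)\<^sup>2) \<le> norm (((D n \<omega>)\<^sup>2 + ((1 + C) / 2)\<^sup>2) / 2)"
        using le by eventually_elim simp
    qed (simp add: e_def)
    have "(\<integral>\<omega>. (e n \<omega>)\<^sup>2 \<partial>M) \<le> (\<integral>\<omega>. ((D n \<omega>)\<^sup>2 + ((1 + C) / 2)\<^sup>2) / 2 \<partial>M)"
      by (rule integral_mono_AE[OF * i le])
    also have "\<dots> \<le> c"
      using D2[of n] by (simp add: c_def M.prob_space)
    finally show "(\<integral>\<omega>. (e n \<omega>)\<^sup>2 \<partial>M) \<le> c" .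
  qed
  have e_mean: "(\<integral>\<omega>. \<phi> \<omega> * e n \<omega> \<partial>M) = 0"
    if \<phi>: "\<phi> \<in> borel_measurable (H n)" "\<And>\<omega>. \<bar>\<phi> \<omega>\<bar> \<le> B" for \<phi> B n
  proof -
    interpret finite_measure_subalgebra M "H n"
      by unfold_locales (rule sub)
    have [measurable]: "\<phi> \<in> borel_measurable M"
      by (rule measurable_from_subalg[OF sub \<phi>(1)])
    have i: "integrable M (\<lambda>\<omega>. \<phi> \<omega> * D n \<omega>)"
    proof (rule Bochner_Integration.integrable_bound)
      show "integrable M (\<lambda>\<omega>. B * D n \<omega>)" using D_int by simp
      have "\<bar>\<phi> \<omega>\<bar> \<le> \<bar>B\<bar>" for \<omega> using \<phi>(2)[of \<omega>] by linarith
      then show "AE \<omega> in M. norm (\<phi> \<omega> * D n \<omega>) \<le> norm (B * D n \<omega>)"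
        by (auto simp: abs_mult intro!: mult_right_mono AE_I2)
    qed measurable
    note r = real_cond_exp_intg[OF i \<phi>(1) D_meas, folded h_def]
    have "(\<integral>\<omega>. \<phi> \<omega> * e n \<omega> \<partial>M) = (\<integral>\<omega>. (\<phi> \<omega> * D n \<omega> - \<phi> \<omega> * h n \<omega>) / 2 \<partial>M)"
      by (simp add: e_def right_diff_distrib)
    also have "\<dots> = 0"
      using i r by simp
    finally show ?thesis .
  qed
  interpret noise: square_summable_noise M H "\<lambda>n \<omega>. g n * e n \<omega>" "\<lambda>n. (g n)\<^sup>2 * c"
  proof unfold_locales
    show "subalgebra M (H n)" "subalgebra (H (Suc n)) (H n)" for n
      by (rule sub, rule sub_Suc)
    have "h n \<in> borel_measurable (H (Suc n))" for n
      by (rule measurable_from_subalg[OF sub_Suc h_meas])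
    then show "(\<lambda>\<omega>. g n * e n \<omega>) \<in> borel_measurable (H (Suc n))" for n
      using D_H[of n] unfolding e_def by simp
    show "integrable M (\<lambda>\<omega>. (g n * e n \<omega>)\<^sup>2)" for n
      using e2(1)[of n] by (simp add: power_mult_distrib)
    show "(\<integral>\<omega>. (g n * e n \<omega>)\<^sup>2 \<partial>M) \<le> (g n)\<^sup>2 * c" for n
      using e2[of n] by (simp add: power_mult_distrib mult_left_mono)
    show "summable (\<lambda>n. (g n)\<^sup>2 * c)"
      using assms(13) by (simp add: g_def summable_mult2)
    show "(\<integral>\<omega>. \<phi> \<omega> * (g n * e n \<omega>) \<partial>M) = 0"
      if "\<phi> \<in> borel_measurable (H n)" "\<And>\<omega>. \<bar>\<phi> \<omega>\<bar> \<le> B" for n \<phi> B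
      using e_mean[OF that] by (simp add: mult.left_commute[of _ "g n"])
  qed

  define E where "E = {x \<in> {0..1}. (x < 1 \<longrightarrow> d x \<le> 0) \<and> (0 < x \<longrightarrow> 0 \<le> d x)}"
  have d_cont: "continuous_on {0..1} d"
  proof -
    have "continuous_on {0..1} (\<lambda>x. utility lam F cs cw (x, 1 - x))"
      by (rule continuous_on_compose2[OF assms(9)]) (auto intro!: continuous_intros simp: strategies_eq_image)
    then show ?thesis unfolding d_def by (intro continuous_intros) auto
  qed
  have E_ne: "E \<noteq> {}"
    using equilibrium_coordinate_exists[OF d_cont] unfolding E_def by blast
  have g_pos: "0 < g n" for n using assms(11) by (simp add: g_def)
  have g_null: "g \<longlonglongrightarrow> 0"
    using summable_LIMSEQ_zero[OF assms(13)] unfolding g_def by simp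
  have g_div: "filterlim (\<lambda>N. \<Sum>n<N. g n) at_top at_top"
    using assms(12) by (simp add: g_def sum.atLeast1_atMost_eq)
  have "AE \<omega> in M. \<forall>n. h n \<omega> = (\<integral>v. v \<bullet> (1, - 1) \<partial>cycle_law lam F cs cw (P (Suc n) \<omega>))"
    unfolding AE_all_countable by (intro allI h_eq)
  with noise.AE_convergent AE_space
  have "AE \<omega> in M. (\<lambda>n. infdist (P n \<omega>) ((\<lambda>x. (x, 1 - x)) ` E)) \<longlonglongrightarrow> 0"
  proof eventually_elim
    case (elim \<omega>)
    have "\<exists>l. 1 \<le> l \<and> l \<le> C \<and> h n \<omega> / 2 = l * d (q n \<omega>)" for n
      using C(5)[of "P (Suc n) \<omega>"] elim P_eq[of \<omega> n] by (auto simp: d_def)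
    then obtain l where l: "\<And>n. 1 \<le> l n" "\<And>n. l n \<le> C" "\<And>n. h n \<omega> / 2 = l n * d (q n \<omega>)"
      by metis
    have q0: "q 0 \<omega> \<in> {0..1}"
      using start[of \<omega>] elim \<open>p1 \<in> strategies\<close> by (auto simp: q_def strategies_def)
    have recursion: "q (Suc n) \<omega> = max 0 (min 1 (q n \<omega> + g n * (l n * d (q n \<omega>)) + g n * e n \<omega>))" for n
      unfolding l(3)[symmetric] by (rule q_step) (use elim in simp)
    have "(\<lambda>n. infdist (q n \<omega>) E) \<longlonglongrightarrow> 0"
      unfolding E_def
      by (rule projected_ascent_converges[OF recursion q0 g_pos g_null g_div l(1,2) d_cont]) (use elim in simp)
    then have lim: "(\<lambda>n. 2 * infdist (q n \<omega>) E) \<longlonglongrightarrow> 0"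
      by (rule tendsto_mult_right_zero)
    have "infdist (P (Suc n) \<omega>) ((\<lambda>x. (x, 1 - x)) ` E) \<le> 2 * infdist (q n \<omega>) E" for n
      using infdist_strategies_le[OF E_ne] P_eq[of \<omega> n] elim by simp
    then have "(\<lambda>n. infdist (P (Suc n) \<omega>) ((\<lambda>x. (x, 1 - x)) ` E)) \<longlonglongrightarrow> 0"
      by (intro tendsto_sandwich[OF _ _ tendsto_const lim] always_eventually allI infdist_nonneg)
    then show ?case by (rule LIMSEQ_imp_Suc)
  qed
  moreover have "\<forall>x\<in>(\<lambda>x. (x, 1 - x)) ` E. equilibrium lam F cs cw x"
    using equilibrium_iff by (auto simp: E_def d_def)
  moreover have "(\<lambda>x. (x, 1 - x)) ` E \<subseteq> strategies"
    by (auto simp: E_def strategies_eq_image)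
  ultimately show ?thesis
    using E_ne by (intro exI[of _ "(\<lambda>x. (x, 1 - x)) ` E"]) auto
qed

end
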